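(* For each $n$, let $R_n$ be an $n\times n$ random matrix, each of whose entries is an independent copy of a lazy Rademacher random variable. There exist (absolute) positive constants $K,C>0$ for which the following holds. For each positive integer $t$, for all $n$ sufficiently large (depending only on $t$), and for all real $L\ge 2K\sqrt{n}$, with $A=\operatorname{diag}(L,\ldots,L,0)\in\mathbb{R}^{n\times n}$, we have $$\mathbb{P}\left[s_n(A+R_n)\le C\left(\frac{K\sqrt{n}}{L}\right)^t\right]\ge(4C)^{-t}K^{-\frac{(t-1)(t-2)}{2}}(\log(2t))^{1-t}n^{-\frac{t(t-1)}{4}}.$$
   Context: A lazy Rademacher random variable takes the value $0$ with probability $1/2$ and the values $1$ and $-1$ with probability $1/4$ each. $s_n(Q)$ denotes the smallest singular value of an $n\times n$ real matrix $Q$. The matrix $\operatorname{diag}(L,\ldots,L,0)$ is diagonal, with first $n-1$ diagonal entries equal to $L$ and last diagonal entry equal to $0$. *)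

theory Defs
  imports "HOL-Probability.Probability" "Jordan_Normal_Form.Spectral_Radius"
begin

definition lazy_rademacher :: "real pmf" where
  "lazy_rademacher = pmf_of_list [(0, 1/2), (1, 1/4), (-1, 1/4)]"

text \<open>\<^const>\<open>pmf_of_list\<close> only has the listed probabilities when the list is well-formed.\<close>

lemma lazy_rademacher_wf: "pmf_of_list_wf [(0 :: real, 1/2 :: real), (1, 1/4), (-1, 1/4)]"
  by (rule pmf_of_list_wfI) auto

lemma pmf_lazy_rademacher:
  "pmf lazy_rademacher 0 = 1/2" "pmf lazy_rademacher 1 = 1/4" "pmf lazy_rademacher (-1) = 1/4"
  by (simp_all add: lazy_rademacher_def pmf_pmf_of_list[OF lazy_rademacher_wf])

text \<open>
  The joint law of an \<open>n \<times> n\<close> random matrix with independent lazy Rademacher entries, i.e. the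
  image of the product measure on the index set. The second argument of \<^const>\<open>Pi_pmf\<close>
  is the value outside the index set, which \<^const>\<open>Matrix.mat\<close> discards.
\<close>

definition lazy_rademacher_matrix :: "nat \<Rightarrow> real mat pmf" where
  "lazy_rademacher_matrix n =
     map_pmf (Matrix.mat n n) (Pi_pmf ({..<n} \<times> {..<n}) 0 (\<lambda>_. lazy_rademacher))"

text \<open>
  Singular values of a square matrix \<open>Q\<close> are the square roots of the eigenvalues of \<open>Q\<^sup>T Q\<close>.
  For dimension \<open>0\<close> the set of eigenvalues is empty and the value is unspecified.
\<close>

definition singular_values :: "real mat \<Rightarrow> real set" where
  "singular_values Q = sqrt ` {e. eigenvalue (transpose_mat Q * Q) e}"

definition smallest_singular_value :: "real mat \<Rightarrow> real" where
  "smallest_singular_value Q = Min (singular_values Q)"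

text \<open>\<open>diag(L,\<dots>,L,0)\<close>; indices start at \<open>0\<close>, so the last one is \<open>n - 1\<close>.\<close>

definition diag_L0 :: "nat \<Rightarrow> real \<Rightarrow> real mat" where
  "diag_L0 n L = mat_diag n (\<lambda>i. if Suc i < n then L else 0)"

end

theory Submission
  imports Defs
begin

text \<open>
  Write \<open>R\<close> with top left block \<open>R'\<close>, last column \<open>(u, r)\<close> and last row \<open>(v, r)\<close>. Testing
  \<open>A + R\<close> on \<open>(- (L I + R')\<^sup>-\<^sup>1 u, 1)\<close> bounds the smallest singular value by the Schur complement
  \<open>r - \<Sum>\<^sub>k (-1)\<^sup>k (v \<bullet> R'\<^sup>k u) / L\<^sup>k\<^sup>+\<^sup>1\<close>. With probability at least \<open>1/2\<close> the operator norm of \<open>R'\<close> is at most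
  \<open>K \<surd>n\<close>; then the terms with \<open>k \<ge> t - 1\<close> form \<open>v \<bullet> w\<close> for a vector \<open>w\<close> of norm at most
  \<open>(K \<surd>n / L)\<^sup>t\<close>, so it suffices that \<open>r = 0\<close>, that \<open>v \<bullet> R'\<^sup>k u = 0\<close> for \<open>k < t - 1\<close>, and that
  \<open>\<bar>v \<bullet> w\<bar>\<close> is at most that bound.

  A lazy Rademacher variable is the difference of two independent uniform variables on
  \<open>{-1/2, 1/2}\<close>, so \<open>v = \<xi> - \<xi>'\<close> for independent copies \<open>\<xi>\<close>, \<open>\<xi>'\<close>, and the event holds as soon as
  all the linear functionals have the same integer part at \<open>\<xi>\<close> and at \<open>\<xi>'\<close>. By Cauchy-Schwarz with a
  product weight, such a collision has probability at least a constant power divided by the product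
  of the standard deviations of the functionals, which are at most of order \<open>K\<^sup>k n\<^bsup>(k+1)/2\<^esup>\<close>. The integrality of
  \<open>v \<bullet> R'\<^sup>k u\<close> turns smallness into vanishing.
\<close>

subsection \<open>The operator norm\<close>

lemma L2_set_uminus: "L2_set (\<lambda>i. - f i) A = L2_set f A"
  by (simp add: L2_set_def)

lemma L2_set_scale: "L2_set (\<lambda>i. c * f i) A = \<bar>c\<bar> * L2_set f A"
  by (simp add: L2_set_def power_mult_distrib sum_distrib_left[symmetric] real_sqrt_mult)

text \<open>The matrix is a function on pairs, the form in which \<open>Pi_pmf\<close> on
  \<open>I \<times> J\<close> delivers it.\<close>

definition bilin :: "'a set \<Rightarrow> 'b set \<Rightarrow> ('a \<times> 'b \<Rightarrow> real) \<Rightarrow> ('a \<Rightarrow> real) \<Rightarrow> ('b \<Rightarrow> real) \<Rightarrow> real" where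
  "bilin I J f y x = (\<Sum>i\<in>I. \<Sum>j\<in>J. y i * f (i, j) * x j)"

lemma bilin_add:
  "bilin I J f (\<lambda>i. y i + y' i) x = bilin I J f y x + bilin I J f y' x"
  "bilin I J f y (\<lambda>j. x j + x' j) = bilin I J f y x + bilin I J f y x'"
  by (simp_all add: bilin_def algebra_simps sum.distrib)

lemma bilin_scale: "bilin I J f (\<lambda>i. c * y i) (\<lambda>j. d * x j) = c * d * bilin I J f y x"
  by (simp add: bilin_def sum_distrib_left algebra_simps)

lemma L2_set_round_diff_le:
  assumes "finite A" "real (card A) \<le> n"
  shows "L2_set (\<lambda>i. x i - of_int (round (x i))) A \<le> sqrt n / 2"
proof -
  have "L2_set (\<lambda>i. x i - of_int (round (x i))) A \<le> sqrt (\<Sum>i\<in>A. (1/2)\<^sup>2)"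
    unfolding L2_set_def
  proof (intro real_sqrt_le_mono sum_mono)
    fix i
    have "\<bar>x i - of_int (round (x i))\<bar> \<le> 1/2"
      using of_int_round_abs_le[of "x i"] by linarith
    then show "(x i - of_int (round (x i)))\<^sup>2 \<le> (1/2)\<^sup>2"
      by (metis abs_ge_zero power2_abs power_mono)
  qed
  also have "\<dots> = sqrt (real (card A)) / 2"
    by (simp add: real_sqrt_divide power2_eq_square)
  also have "\<dots> \<le> sqrt n / 2" using assms by simp
  finally show ?thesis .
qed

text \<open>
  Rounding \<open>2 \<surd>n x\<close> to the nearest integer vector moves it by at most \<open>\<surd>n / 2\<close>, so the
  supremum \<open>S\<close> of the form over the unit balls satisfies \<open>4 n S \<le> B n\<^bsup>3/2\<^esup> + (9/4) n S\<close>.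
\<close>

lemma op_norm_le_integer_net:
  fixes f :: "'a \<times> 'b \<Rightarrow> real" and n B :: real
  assumes fin: "finite I" "finite J" and card: "real (card I) \<le> n" "real (card J) \<le> n"
    and n: "n > 0" and B: "B \<ge> 0"
    and net: "\<And>(w :: 'a \<Rightarrow> int) (z :: 'b \<Rightarrow> int).
       L2_set (\<lambda>i. of_int (w i)) I \<le> 5/2 * sqrt n \<Longrightarrow> L2_set (\<lambda>j. of_int (z j)) J \<le> 5/2 * sqrt n \<Longrightarrow>
       \<bar>bilin I J f (\<lambda>i. of_int (w i)) (\<lambda>j. of_int (z j))\<bar> \<le> B * (n * sqrt n)"
  shows "L2_set (\<lambda>i. \<Sum>j\<in>J. f (i, j) * x j) I \<le> B * sqrt n * L2_set x J"
proof -
  define V where "V = {\<bar>bilin I J f y x\<bar> | x y. L2_set x J \<le> 1 \<and> L2_set y I \<le> 1}"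
  define S where "S = Sup V"
  have ball: "\<bar>u i\<bar> \<le> 1" if "finite A" "i \<in> A" "L2_set u A \<le> 1" for u :: "'c \<Rightarrow> real" and i A
    using member_le_L2_set[of A i u] member_le_L2_set[of A i "\<lambda>i. - u i"] that
    by (simp add: L2_set_uminus abs_le_iff)
  have bdd: "bdd_above V"
  proof (rule bdd_aboveI)
    fix v assume "v \<in> V"
    then obtain x y where v: "v = \<bar>bilin I J f y x\<bar>" "L2_set x J \<le> 1" "L2_set y I \<le> 1"
      by (auto simp: V_def)
    have "v \<le> (\<Sum>i\<in>I. \<Sum>j\<in>J. \<bar>y i * f (i, j) * x j\<bar>)"
      unfolding v bilin_def by (intro order_trans[OF sum_abs] sum_mono sum_abs)
    also have "\<dots> \<le> (\<Sum>i\<in>I. \<Sum>j\<in>J. 1 * \<bar>f (i, j)\<bar> * 1)"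
      unfolding abs_mult
      by (intro sum_mono mult_mono ball[OF fin(1)] ball[OF fin(2)] v) auto
    finally show "v \<le> (\<Sum>i\<in>I. \<Sum>j\<in>J. 1 * \<bar>f (i, j)\<bar> * 1)" .
  qed
  have "0 \<in> V"
    unfolding V_def by (rule CollectI, rule exI[of _ "\<lambda>_. 0"], rule exI[of _ "\<lambda>_. 0"])
      (simp add: bilin_def L2_set_def)
  \<comment> \<open>Homogeneity carries the supremum from the unit balls to balls of any positive
    radii.\<close>
  have S: "\<bar>bilin I J f y x\<bar> \<le> a * b * S"
    if "a > 0" "b > 0" "L2_set y I \<le> a" "L2_set x J \<le> b" for a b x y
  proof -
    have "L2_set (\<lambda>i. inverse a * y i) I \<le> 1" "L2_set (\<lambda>i. inverse b * x i) J \<le> 1"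
      unfolding L2_set_scale using that by (simp_all add: field_simps)
    then have "\<bar>bilin I J f (\<lambda>i. inverse a * y i) (\<lambda>i. inverse b * x i)\<bar> \<le> S"
      unfolding S_def by (intro cSup_upper bdd) (auto simp: V_def)
    then show ?thesis
      unfolding bilin_scale abs_mult using that by (simp add: field_simps)
  qed
  have sq: "sqrt n > 0" "sqrt n * sqrt n = n" using n by simp_all
  have "v \<le> (B * sqrt n + 9/4 * S) / 4" if "v \<in> V" for v
  proof -
    obtain x y where v: "v = \<bar>bilin I J f y x\<bar>" "L2_set x J \<le> 1" "L2_set y I \<le> 1"
      using \<open>v \<in> V\<close> by (auto simp: V_def)
    \<comment> \<open>At this scale a vector of the unit ball gets norm at most 2 sqrt n, and
      rounding adds at most sqrt n / 2; this is the radius 5/2 sqrt n in \<open>net\<close>.\<close>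
    define c where "c = 2 * sqrt n"
    have c: "c > 0" "c * c = 4 * n" using n by (simp_all add: c_def)
    define w e where "w i = round (c * y i)" and "e i = c * y i - of_int (w i)" for i
    define z g where "z j = round (c * x j)" and "g j = c * x j - of_int (z j)" for j
    have e: "L2_set e I \<le> sqrt n / 2" and g: "L2_set g J \<le> sqrt n / 2"
      unfolding e_def w_def g_def z_def by (intro L2_set_round_diff_le fin card)+
    have cy: "L2_set (\<lambda>i. c * y i) I \<le> 2 * sqrt n" and cx: "L2_set (\<lambda>i. c * x i) J \<le> 2 * sqrt n"
      unfolding L2_set_scale using v sq by (simp_all add: c_def mult_left_le)
    have w: "L2_set (\<lambda>i. of_int (w i)) I \<le> 5/2 * sqrt n"
      using L2_set_triangle_ineq[of "\<lambda>i. c * y i" "\<lambda>i. - e i" I] cy e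
      unfolding L2_set_uminus e_def[abs_def] by simp
    have z: "L2_set (\<lambda>i. of_int (z i)) J \<le> 5/2 * sqrt n"
      using L2_set_triangle_ineq[of "\<lambda>i. c * x i" "\<lambda>i. - g i" J] cx g
      unfolding L2_set_uminus g_def[abs_def] by simp
    have "c * c * bilin I J f y x = bilin I J f (\<lambda>i. of_int (w i) + e i) (\<lambda>j. c * x j)"
      by (simp add: bilin_scale[symmetric] e_def)
    also have "\<dots> = bilin I J f (\<lambda>i. of_int (w i)) (\<lambda>j. of_int (z j) + g j) + bilin I J f e (\<lambda>j. c * x j)"
      by (simp add: bilin_add g_def)
    also have "\<dots> = bilin I J f (\<lambda>i. of_int (w i)) (\<lambda>j. of_int (z j)) +
        bilin I J f (\<lambda>i. of_int (w i)) g + bilin I J f e (\<lambda>j. c * x j)"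
      by (simp add: bilin_add)
    finally have eq: "4 * n * bilin I J f y x = \<dots>" by (simp add: c)
    have "4 * n * v = \<bar>4 * n * bilin I J f y x\<bar>" using n v by (simp add: abs_mult)
    \<comment> \<open>The integer part is bounded by \<open>net\<close>, the two error terms by
      \<open>S\<close>: 5/2 times 1/2 plus 1/2 times 2 is 9/4. As 9/4 < 4, the supremum can be
      absorbed on the left.\<close>
    also have "\<dots> \<le> B * (n * sqrt n) + (5/2 * sqrt n) * (sqrt n / 2) * S + (sqrt n / 2) * (2 * sqrt n) * S"
      unfolding eq
      using net[OF w z] S[OF _ _ w g] S[OF _ _ e cx] sq by linarith
    also have "\<dots> = n * (B * sqrt n + 9/4 * S)"
      using sq(2) by (simp add: algebra_simps)
    finally have "n * (4 * v) \<le> n * (B * sqrt n + 9/4 * S)" by (simp add: algebra_simps)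
    then show ?thesis using n by simp
  qed
  then have "S \<le> (B * sqrt n + 9/4 * S) / 4"
    unfolding S_def by (intro cSup_least) (use \<open>0 \<in> V\<close> in auto)
  moreover have "B * sqrt n \<ge> 0" using B n by simp
  ultimately have SB: "S \<le> B * sqrt n" by simp
  \<comment> \<open>Testing the form against the image vector itself turns the bound on
    \<open>S\<close> into a bound on the norm. Zero norms are treated apart because \<open>S\<close>
    asks for positive radii.\<close>
  define y where "y i = (\<Sum>j\<in>J. f (i, j) * x j)" for i
  show ?thesis
  proof (cases "L2_set y I = 0 \<or> L2_set x J = 0")
    case True
    have "L2_set y I = 0" if "L2_set x J = 0"
    proof -
      have "\<forall>j\<in>J. x j = 0" using that fin by (simp add: L2_set_eq_0_iff)
      then show ?thesis by (simp add: y_def L2_set_def)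
    qed
    with True have "L2_set y I = 0" by auto
    then show ?thesis
      using mult_nonneg_nonneg[OF \<open>B * sqrt n \<ge> 0\<close> L2_set_nonneg[of x J]] by (simp add: y_def[abs_def])
  next
    case False
    then have pos: "L2_set y I > 0" "L2_set x J > 0"
      by (simp_all add: less_le)
    have "L2_set y I * L2_set y I = (\<Sum>i\<in>I. y i * y i)"
      by (simp add: L2_set_def sum_nonneg power2_eq_square)
    also have "\<dots> = bilin I J f y x"
      by (simp add: bilin_def y_def sum_distrib_left algebra_simps)
    also have "\<dots> \<le> L2_set y I * L2_set x J * S"
      using S[OF pos order_refl order_refl] by linarith
    finally have "L2_set y I \<le> L2_set x J * S" using pos by simp
    also have "\<dots> \<le> L2_set x J * (B * sqrt n)" using SB by (intro mult_left_mono) auto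
    finally have "L2_set y I \<le> B * sqrt n * L2_set x J" by (simp only: mult.commute)
    then show ?thesis unfolding y_def[abs_def] .
  qed
qed

section \<open>Exponential moments and tails of lazy Rademacher sums\<close>

lemma set_lazy_rademacher: "set_pmf lazy_rademacher = {0, 1, -1}"
proof -
  have "set_pmf lazy_rademacher \<subseteq> {0, 1, -1}"
    unfolding lazy_rademacher_def using set_pmf_of_list[OF lazy_rademacher_wf] by simp
  moreover have "{0, 1, -1} \<subseteq> set_pmf lazy_rademacher"
    by (auto simp: set_pmf_iff pmf_lazy_rademacher)
  ultimately show ?thesis by blast
qed

lemma expectation_lazy_rademacher:
  "measure_pmf.expectation lazy_rademacher g = (g 0 :: real) / 2 + g 1 / 4 + g (-1) / 4"
  by (subst integral_measure_pmf[of "{0, 1, -1}"])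
     (auto simp: set_lazy_rademacher pmf_lazy_rademacher)

text \<open>The two power series are compared term by term, using 2^n n! \<le> (2n)!.\<close>

lemma cosh_le_exp_half_square: "cosh (x :: real) \<le> exp (x\<^sup>2 / 2)"
proof -
  have "(\<lambda>n. if even n then x ^ n /\<^sub>R fact n else 0) sums cosh x"
    by (rule cosh_converges)
  then have "(\<lambda>n. if even (2 * n) then x ^ (2 * n) /\<^sub>R fact (2 * n) else 0) sums cosh x"
    by (subst sums_mono_reindex[of "\<lambda>n. 2 * n"]) (auto simp: strict_mono_def elim!: evenE)
  then have 1: "(\<lambda>n. x ^ (2 * n) / fact (2 * n)) sums cosh x"
    by (simp add: field_simps)
  have 2: "(\<lambda>n. (x\<^sup>2 / 2) ^ n / fact n) sums exp (x\<^sup>2 / 2)"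
    using exp_converges[of "x\<^sup>2 / 2"] by (simp add: field_simps)
  show ?thesis
  proof (rule sums_le[OF _ 1 2])
    fix n
    have "(2 :: real) ^ n * fact n \<le> fact (2 * n)"
    proof (induction n)
      case (Suc n)
      have "(2::real) ^ Suc n * fact (Suc n) = (2 * (real n + 1)) * (2 ^ n * fact n)"
        by (simp add: algebra_simps)
      also have "\<dots> \<le> (2 * (real n + 1)) * fact (2 * n)"
        using Suc by (intro mult_left_mono) auto
      also have "\<dots> \<le> (2 * real n + 2) * (2 * real n + 1) * fact (2 * n)"
        by (intro mult_right_mono) (auto simp: algebra_simps)
      also have "\<dots> = fact (2 * Suc n)"
        by (simp add: algebra_simps)
      finally show ?case .
    qed simp
    then have "x ^ (2 * n) / fact (2 * n) \<le> x ^ (2 * n) / (2 ^ n * fact n)"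
      by (intro divide_left_mono) auto
    also have "\<dots> = (x\<^sup>2 / 2) ^ n / fact n"
      by (simp add: power_mult power_divide)
    finally show "x ^ (2 * n) / fact (2 * n) \<le> (x\<^sup>2 / 2) ^ n / fact n" .
  qed
qed

lemma finite_set_Pi_lazy: "finite G \<Longrightarrow> finite (set_pmf (Pi_pmf G 0 (\<lambda>_. lazy_rademacher)))"
  by (subst set_Pi_pmf) (auto intro!: finite_PiE_dflt simp: set_lazy_rademacher)

text \<open>By independence the expectation factorises. Each factor is 1/2 + cosh(c)/2, at most
  cosh(c) because cosh \<ge> 1, hence at most exp(c^2/2).\<close>

lemma mgf_lazy_rademacher_le:
  fixes c :: "'a \<Rightarrow> real"
  assumes "finite G"
  shows "measure_pmf.expectation (Pi_pmf G 0 (\<lambda>_. lazy_rademacher)) (\<lambda>f. exp (\<Sum>e\<in>G. c e * f e))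
           \<le> exp ((\<Sum>e\<in>G. (c e)\<^sup>2) / 2)"
proof -
  have "measure_pmf.expectation (Pi_pmf G 0 (\<lambda>_. lazy_rademacher)) (\<lambda>f. exp (\<Sum>e\<in>G. c e * f e)) =
    measure_pmf.expectation (Pi_pmf G 0 (\<lambda>_. lazy_rademacher)) (\<lambda>f. \<Prod>e\<in>G. exp (c e * f e))"
    using assms by (simp add: exp_sum)
  also have "\<dots> = (\<Prod>e\<in>G. measure_pmf.expectation lazy_rademacher (\<lambda>r. exp (c e * r)))"
    by (rule expectation_prod_Pi_pmf[OF assms])
      (simp_all add: set_lazy_rademacher integrable_measure_pmf_finite)
  also have "\<dots> \<le> (\<Prod>e\<in>G. exp ((c e)\<^sup>2 / 2))"
  proof (intro prod_mono conjI)
    fix e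
    have "measure_pmf.expectation lazy_rademacher (\<lambda>r. exp (c e * r)) = 1 / 2 + cosh (c e) / 2"
      by (simp add: expectation_lazy_rademacher cosh_field_def)
    also have "\<dots> \<le> cosh (c e)" using cosh_real_ge_1[of "c e"] by simp
    also have "\<dots> \<le> exp ((c e)\<^sup>2 / 2)" by (rule cosh_le_exp_half_square)
    finally show "measure_pmf.expectation lazy_rademacher (\<lambda>r. exp (c e * r)) \<le> exp ((c e)\<^sup>2 / 2)" .
  qed simp
  also have "\<dots> = exp ((\<Sum>e\<in>G. (c e)\<^sup>2) / 2)"
    using assms by (simp add: exp_sum[symmetric] sum_divide_distrib)
  finally show ?thesis .
qed

text \<open>Chernoff's bound with exponential parameter 1; other parameters are reached by rescaling
  \<open>c\<close> and \<open>a\<close>.\<close>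

lemma lazy_rademacher_tail:
  fixes c :: "'a \<Rightarrow> real"
  assumes "finite G"
  shows "measure_pmf.prob (Pi_pmf G 0 (\<lambda>_. lazy_rademacher)) {f. (\<Sum>e\<in>G. c e * f e) \<ge> a}
           \<le> exp ((\<Sum>e\<in>G. (c e)\<^sup>2) / 2 - a)"
proof -
  let ?P = "Pi_pmf G 0 (\<lambda>_. lazy_rademacher)"
  have int: "integrable (measure_pmf ?P) g" for g :: "_ \<Rightarrow> real"
    by (rule integrable_measure_pmf_finite[OF finite_set_Pi_lazy[OF assms]])
  have "measure_pmf.prob ?P {f. (\<Sum>e\<in>G. c e * f e) \<ge> a} =
     measure_pmf.expectation ?P (indicator {f. (\<Sum>e\<in>G. c e * f e) \<ge> a})"
    by simp
  also have "\<dots> \<le> measure_pmf.expectation ?P (\<lambda>f. exp (- a) * exp (\<Sum>e\<in>G. c e * f e))"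
    by (rule integral_mono[OF int int]) (auto simp: indicator_def exp_add[symmetric])
  also have "\<dots> = exp (- a) * measure_pmf.expectation ?P (\<lambda>f. exp (\<Sum>e\<in>G. c e * f e))"
    by (rule integral_mult_right_zero)
  also have "\<dots> \<le> exp (- a) * exp ((\<Sum>e\<in>G. (c e)\<^sup>2) / 2)"
    by (intro mult_left_mono mgf_lazy_rademacher_le assms) simp
  finally show ?thesis by (simp add: exp_add[symmetric])
qed

section \<open>Counting integer points\<close>

text \<open>Over all integers this is a two-sided geometric series with value (1 + q)/(1 - q), where
  q = exp(-2/s). It is used with s = 2 to count integer points and with general s for the weights of
  the small ball estimate.\<close>

lemma sum_exp_abs_int_le:
  fixes T :: "int set"
  assumes "finite T" "s \<ge> 1"
  shows "(\<Sum>c\<in>T. exp (- 2 * real_of_int \<bar>c\<bar> / s)) \<le> 2 * s"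
proof -
  define q where "q = exp (- 2 / s)"
  have q: "0 < q" "q < 1" using assms by (simp_all add: q_def)
  have pow: "exp (- 2 * real i / s) = q ^ i" for i
    by (simp add: q_def exp_of_nat_mult[symmetric])
  have pow': "exp (- 2 * real_of_int \<bar>- int (Suc i)\<bar> / s) = q ^ Suc i" for i
    unfolding abs_minus_cancel abs_of_nat of_int_of_nat_eq by (rule pow)
  define M where "M = nat (Max (insert 0 (abs ` T)))"
  have M: "\<bar>c\<bar> \<le> int M" if "c \<in> T" for c
    using that assms by (auto simp: M_def intro!: Max_ge)
  \<comment> \<open>The negative half starts at \<open>Suc 0\<close>, so zero is counted once and
    the two halves are disjoint.\<close>
  have sub: "T \<subseteq> int ` {..M} \<union> (\<lambda>i. - int (Suc i)) ` {..M}"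
  proof
    fix c assume c: "c \<in> T"
    show "c \<in> int ` {..M} \<union> (\<lambda>i. - int (Suc i)) ` {..M}"
    proof (cases "c \<ge> 0")
      case True
      then have "c = int (nat c)" "nat c \<le> M" using M[OF c] by auto
      then show ?thesis by blast
    next
      case False
      then have "c = - int (Suc (nat (- c - 1)))" "nat (- c - 1) \<le> M" using M[OF c] by auto
      then show ?thesis by blast
    qed
  qed
  have "(\<Sum>c\<in>T. exp (- 2 * real_of_int \<bar>c\<bar> / s)) \<le>
      (\<Sum>c\<in>int ` {..M} \<union> (\<lambda>i. - int (Suc i)) ` {..M}. exp (- 2 * real_of_int \<bar>c\<bar> / s))"
    by (rule sum_mono2[OF _ sub]) auto
  also have "\<dots> = (\<Sum>c\<in>int ` {..M}. exp (- 2 * real_of_int \<bar>c\<bar> / s)) +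
      (\<Sum>c\<in>(\<lambda>i. - int (Suc i)) ` {..M}. exp (- 2 * real_of_int \<bar>c\<bar> / s))"
    by (rule sum.union_disjoint) auto
  also have "\<dots> = (\<Sum>i\<le>M. q ^ i) + (\<Sum>i\<le>M. q ^ Suc i)"
  proof (subst (1 2) sum.reindex)
    show "sum ((\<lambda>c. exp (- 2 * real_of_int \<bar>c\<bar> / s)) \<circ> int) {..M} +
        sum ((\<lambda>c. exp (- 2 * real_of_int \<bar>c\<bar> / s)) \<circ> (\<lambda>i. - int (Suc i))) {..M} =
      (\<Sum>i\<le>M. q ^ i) + (\<Sum>i\<le>M. q ^ Suc i)"
      by (simp only: o_def pow pow' abs_of_nat of_int_of_nat_eq)
  qed (auto simp: inj_on_def)
  also have "\<dots> = (1 + q) * (\<Sum>i\<le>M. q ^ i)"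
    by (simp add: sum_distrib_left algebra_simps)
  also have "\<dots> \<le> (1 + q) * (1 / (1 - q))"
  proof (rule mult_left_mono)
    have "(\<Sum>i\<le>M. q ^ i) \<le> (\<Sum>i. q ^ i)"
      using q by (intro sum_le_suminf summable_geometric) auto
    then show "(\<Sum>i\<le>M. q ^ i) \<le> 1 / (1 - q)" using q by (simp add: suminf_geometric)
  qed (use q in simp)
  also have "\<dots> \<le> 2 * s"
  proof -
    \<comment> \<open>From exp x \<ge> 1 + x follows q \<le> s/(s + 2), so (1 + q)/(1 - q) is at
      most s + 1, which is at most 2s since s \<ge> 1.\<close>
    have "1 + 2 / s \<le> exp (2 / s)" by (rule exp_ge_add_one_self)
    then have "q * (1 + 2 / s) \<le> 1"
      by (simp add: q_def exp_minus field_simps)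
    then have "q * (s + 2) \<le> s" using assms by (simp add: field_simps)
    then have "1 + q \<le> (1 - q) * (s + 1)" by (simp add: algebra_simps)
    also have "\<dots> \<le> (1 - q) * (2 * s)" using q assms by (intro mult_left_mono) auto
    finally show ?thesis using q by (simp add: field_simps)
  qed
  finally show ?thesis .
qed

text \<open>Counted by the weight \<open>exp (- \<Sum>\<bar>z\<^sub>i\<bar>)\<close>, whose sum over \<open>\<int>\<^sup>A\<close> factorises.\<close>

lemma card_integer_ball_le:
  fixes A :: "'a set" and n :: real
  assumes fin: "finite A" and card: "real (card A) \<le> n"
    and T: "T \<subseteq> {z \<in> A \<rightarrow>\<^sub>E (UNIV :: int set). L2_set (\<lambda>i. of_int (z i)) A \<le> r}" and r: "r \<ge> 0"
  shows "finite T \<and> real (card T) \<le> 4 powr n * exp (r\<^sup>2)"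
proof -
  define R where "R = {- \<lfloor>r\<rfloor>..\<lfloor>r\<rfloor>}"
  have sub: "T \<subseteq> A \<rightarrow>\<^sub>E R"
  proof
    fix z assume z: "z \<in> T"
    have "z i \<in> R" if "i \<in> A" for i
    proof -
      have "\<bar>real_of_int (z i)\<bar> \<le> L2_set (\<lambda>i. of_int (z i)) A"
        using member_le_L2_set[OF fin that, of "\<lambda>i. of_int (z i)"]
          member_le_L2_set[OF fin that, of "\<lambda>i. - of_int (z i)"]
        by (simp add: L2_set_uminus abs_le_iff)
      also have "\<dots> \<le> r" using z T by auto
      finally have "\<bar>z i\<bar> \<le> \<lfloor>r\<rfloor>" by linarith
      then show ?thesis by (auto simp: R_def)
    qed
    then show "z \<in> A \<rightarrow>\<^sub>E R" using z T by (auto simp: PiE_iff)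
  qed
  have finR: "finite R" by (simp add: R_def)
  then have finT: "finite T" using sub fin by (meson finite_PiE finite_subset)
  have "real (card T) = (\<Sum>z\<in>T. 1)" by simp
  \<comment> \<open>Every point of \<open>T\<close> has weight at least 1, since integers satisfy
    \<bar>z\<bar> \<le> z^2. The exponent is left as -2\<bar>z\<bar>/2 to match
    \<open>sum_exp_abs_int_le\<close> with s = 2, which gives a factor 4 per coordinate.\<close>
  also have "\<dots> \<le> (\<Sum>z\<in>T. exp (r\<^sup>2) * (\<Prod>i\<in>A. exp (- 2 * real_of_int \<bar>z i\<bar> / 2)))"
  proof (rule sum_mono)
    fix z assume "z \<in> T"
    then have "L2_set (\<lambda>i. of_int (z i)) A \<le> r" using T by auto
    then have "(L2_set (\<lambda>i. of_int (z i)) A)\<^sup>2 \<le> r\<^sup>2" by (intro power_mono) auto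
    then have "(\<Sum>i\<in>A. (real_of_int (z i))\<^sup>2) \<le> r\<^sup>2"
      by (simp add: L2_set_def sum_nonneg)
    moreover have "(\<Sum>i\<in>A. real_of_int \<bar>z i\<bar>) \<le> (\<Sum>i\<in>A. (real_of_int (z i))\<^sup>2)"
    proof (rule sum_mono)
      fix i
      have "\<bar>z i\<bar> * 1 \<le> \<bar>z i\<bar> * \<bar>z i\<bar>"
        by (cases "z i = 0") (auto intro!: mult_left_mono[of 1 "\<bar>z i\<bar>" "\<bar>z i\<bar>", simplified])
      then have "\<bar>z i\<bar> \<le> (z i)\<^sup>2" by (simp add: power2_eq_square)
      then show "real_of_int \<bar>z i\<bar> \<le> (real_of_int (z i))\<^sup>2"
        by (metis of_int_le_iff of_int_power)
    qed
    ultimately have "1 \<le> exp (r\<^sup>2 - (\<Sum>i\<in>A. real_of_int \<bar>z i\<bar>))" by simp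
    also have "\<dots> = exp (r\<^sup>2) * (\<Prod>i\<in>A. exp (- 2 * real_of_int \<bar>z i\<bar> / 2))"
      by (simp add: exp_sum[OF fin, symmetric] exp_add[symmetric] sum_negf)
    finally show "1 \<le> exp (r\<^sup>2) * (\<Prod>i\<in>A. exp (- 2 * real_of_int \<bar>z i\<bar> / 2))" .
  qed
  also have "\<dots> \<le> (\<Sum>z\<in>A \<rightarrow>\<^sub>E R. exp (r\<^sup>2) * (\<Prod>i\<in>A. exp (- 2 * real_of_int \<bar>z i\<bar> / 2)))"
    by (rule sum_mono2[OF _ sub]) (use fin finR in \<open>auto intro!: finite_PiE mult_nonneg_nonneg prod_nonneg\<close>)
  also have "\<dots> = exp (r\<^sup>2) * (\<Prod>i\<in>A. \<Sum>c\<in>R. exp (- 2 * real_of_int \<bar>c\<bar> / 2))"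
    using fin finR by (simp only: sum_distrib_left[symmetric] prod_sum_PiE)
  also have "\<dots> \<le> exp (r\<^sup>2) * (\<Prod>i\<in>A. 2 * 2)"
    by (intro mult_left_mono prod_mono conjI sum_nonneg sum_exp_abs_int_le finR) auto
  also have "\<dots> = exp (r\<^sup>2) * 4 powr real (card A)"
    by (simp add: powr_realpow)
  also have "\<dots> \<le> exp (r\<^sup>2) * 4 powr n"
    using card by (intro mult_left_mono powr_mono) auto
  finally show ?thesis using finT by (simp add: mult.commute)
qed


text \<open>Union bound over the integer points required by \<open>op_norm_le_integer_net\<close>:
  there are at most exp(33/2 n) pairs, and each fails with probability at most exp(-20 n). As
  \<open>n\<close> only bounds the two dimensions, rectangular blocks are covered.\<close>

theorem lazy_rademacher_op_norm:
  fixes n :: real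
  assumes fin: "finite I" "finite J" and card: "real (card I) \<le> n" "real (card J) \<le> n"
    and n: "n \<ge> 1"
  shows "measure_pmf.prob (Pi_pmf (I \<times> J) 0 (\<lambda>_. lazy_rademacher))
     {f. \<forall>x. L2_set (\<lambda>i. \<Sum>j\<in>J. f (i, j) * x j) I \<le> 40 * sqrt n * L2_set x J} \<ge> 1/2"
    (is "measure_pmf.prob ?P ?Q \<ge> _")
proof -
  define r where "r = 5/2 * sqrt n"
  have r: "r \<ge> 0" "r\<^sup>2 = 25/4 * n" using n by (simp_all add: r_def power_mult_distrib power2_eq_square)
  define W where "W = {w \<in> I \<rightarrow>\<^sub>E (UNIV :: int set). L2_set (\<lambda>i. of_int (w i)) I \<le> r}"
  define Z where "Z = {z \<in> J \<rightarrow>\<^sub>E (UNIV :: int set). L2_set (\<lambda>i. of_int (z i)) J \<le> r}"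
  have W: "finite W" "real (card W) \<le> 4 powr n * exp (r\<^sup>2)"
    using card_integer_ball_le[OF fin(1) card(1) order_refl r(1)] by (simp_all add: W_def)
  have Z: "finite Z" "real (card Z) \<le> 4 powr n * exp (r\<^sup>2)"
    using card_integer_ball_le[OF fin(2) card(2) order_refl r(1)] by (simp_all add: Z_def)
  \<comment> \<open>Dividing by sqrt n amounts to the Chernoff parameter 1/sqrt n: the level 40 n
    sqrt n becomes 40 n and the squared coefficients sum to order n.\<close>
  define E where "E p = {f. (\<Sum>e\<in>I \<times> J. (real_of_int (fst p (fst e)) * real_of_int (snd p (snd e)) / sqrt n) * f e) \<ge> 40 * n}"
    for p :: "('a \<Rightarrow> int) \<times> ('b \<Rightarrow> int)"
  have E: "measure_pmf.prob ?P (E p) \<le> exp (- 20 * n)" if p: "p \<in> W \<times> Z" for p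
  proof -
    obtain w z where wz: "p = (w, z)" "w \<in> W" "z \<in> Z" using p by auto
    have sq: "(\<Sum>i\<in>A. (real_of_int (u i))\<^sup>2) \<le> 25/4 * n"
      if "L2_set (\<lambda>i. of_int (u i)) A \<le> r" for u and A :: "'c set"
    proof -
      have "(L2_set (\<lambda>i. of_int (u i)) A)\<^sup>2 \<le> r\<^sup>2" using that by (intro power_mono) auto
      then show ?thesis by (simp add: r L2_set_def sum_nonneg)
    qed
    have "(\<Sum>e\<in>I \<times> J. (real_of_int (w (fst e)) * real_of_int (z (snd e)) / sqrt n)\<^sup>2) =
       (\<Sum>i\<in>I. (real_of_int (w i))\<^sup>2) * (\<Sum>j\<in>J. (real_of_int (z j))\<^sup>2) / n"
      using n by (simp add: sum.cartesian_product' sum_product sum_divide_distrib power_divide power_mult_distrib)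
    also have "\<dots> \<le> (25/4 * n) * (25/4 * n) / n"
      using wz n by (intro divide_right_mono mult_mono sq sum_nonneg) (auto simp: W_def Z_def)
    also have "\<dots> = 625/16 * n" using n by simp
    finally have S: "(\<Sum>e\<in>I \<times> J. (real_of_int (w (fst e)) * real_of_int (z (snd e)) / sqrt n)\<^sup>2) \<le> 625/16 * n" .
    have "measure_pmf.prob ?P (E p) \<le>
       exp ((\<Sum>e\<in>I \<times> J. (real_of_int (w (fst e)) * real_of_int (z (snd e)) / sqrt n)\<^sup>2) / 2 - 40 * n)"
      unfolding E_def wz fst_conv snd_conv by (rule lazy_rademacher_tail) (use fin in simp)
    \<comment> \<open>Half of 625/16 is below 20, which leaves an exponent below -20 n.\<close>
    also have "\<dots> \<le> exp (- 20 * n)" using S n by simp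
    finally show ?thesis .
  qed
  have sub: "- ?Q \<subseteq> (\<Union>p\<in>W \<times> Z. E p)"
  proof
    fix f assume "f \<in> - ?Q"
    show "f \<in> (\<Union>p\<in>W \<times> Z. E p)"
    proof (rule ccontr)
      assume nE: "f \<notin> (\<Union>p\<in>W \<times> Z. E p)"
      have le: "bilin I J f (\<lambda>i. of_int (w i)) (\<lambda>j. of_int (z j)) \<le> 40 * (n * sqrt n)"
        if "L2_set (\<lambda>i. of_int (w i)) I \<le> r" "L2_set (\<lambda>j. of_int (z j)) J \<le> r"
        for w :: "'a \<Rightarrow> int" and z :: "'b \<Rightarrow> int"
      proof -
        \<comment> \<open>\<open>W\<close> and \<open>Z\<close> hold extensional functions, which
          makes them finite; restriction changes no value that enters the form.\<close>
        have "(restrict w I, restrict z J) \<in> W \<times> Z"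
          using that by (simp add: W_def Z_def cong: L2_set_cong_simp)
        then have "f \<notin> E (restrict w I, restrict z J)" using nE by blast
        moreover have "(\<Sum>e\<in>I \<times> J. real_of_int (restrict w I (fst e)) * real_of_int (restrict z J (snd e)) / sqrt n * f e) =
            (\<Sum>e\<in>I \<times> J. real_of_int (w (fst e)) * real_of_int (z (snd e)) / sqrt n * f e)"
          by (rule sum.cong) auto
        ultimately have "(\<Sum>e\<in>I \<times> J. real_of_int (w (fst e)) * real_of_int (z (snd e)) / sqrt n * f e) < 40 * n"
          by (simp add: E_def not_le)
        also have "(\<Sum>e\<in>I \<times> J. real_of_int (w (fst e)) * real_of_int (z (snd e)) / sqrt n * f e) =
            bilin I J f (\<lambda>i. of_int (w i)) (\<lambda>j. of_int (z j)) / sqrt n"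
          by (simp add: bilin_def sum.cartesian_product' sum_divide_distrib mult_ac)
        finally show ?thesis using n by (simp add: field_simps)
      qed
      have "f \<in> ?Q"
      proof (rule CollectI, rule allI)
        fix x
        show "L2_set (\<lambda>i. \<Sum>j\<in>J. f (i, j) * x j) I \<le> 40 * sqrt n * L2_set x J"
        proof (rule op_norm_le_integer_net[OF fin card])
          fix w z assume wz: "L2_set (\<lambda>i. of_int (w i)) I \<le> 5/2 * sqrt n" "L2_set (\<lambda>j. of_int (z j)) J \<le> 5/2 * sqrt n"
          \<comment> \<open>The tail events are one-sided. The vector -w lies in the same ball and
            supplies the other sign.\<close>
          have "bilin I J f (\<lambda>i. of_int (- w i)) (\<lambda>j. of_int (z j)) =
              - bilin I J f (\<lambda>i. of_int (w i)) (\<lambda>j. of_int (z j))"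
            using bilin_scale[of I J f "-1" "\<lambda>i. of_int (w i)" 1] by simp
          then show "\<bar>bilin I J f (\<lambda>i. of_int (w i)) (\<lambda>j. of_int (z j))\<bar> \<le> 40 * (n * sqrt n)"
            using le[of w z] le[of "\<lambda>i. - w i" z] wz
            by (simp add: r_def L2_set_uminus abs_le_iff)
        qed (use n in auto)
      qed
      with \<open>f \<in> - ?Q\<close> show False by blast
    qed
  qed
  have "measure_pmf.prob ?P (- ?Q) \<le> measure_pmf.prob ?P (\<Union>p\<in>W \<times> Z. E p)"
    by (rule measure_pmf.finite_measure_mono[OF sub]) simp
  also have "\<dots> \<le> (\<Sum>p\<in>W \<times> Z. measure_pmf.prob ?P (E p))"
    by (rule measure_pmf.finite_measure_subadditive_finite) (use W Z in auto)
  also have "\<dots> \<le> (\<Sum>p\<in>W \<times> Z. exp (- 20 * n))"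
    by (rule sum_mono[OF E])
  also have "\<dots> = real (card W) * real (card Z) * exp (- 20 * n)"
    by (simp add: card_cartesian_product)
  also have "\<dots> \<le> (4 powr n * exp (r\<^sup>2)) * (4 powr n * exp (r\<^sup>2)) * exp (- 20 * n)"
    using W Z by (intro mult_mono) auto
  also have "\<dots> \<le> (exp (2 * n) * exp (r\<^sup>2)) * (exp (2 * n) * exp (r\<^sup>2)) * exp (- 20 * n)"
  proof -
    have "4 \<le> exp (2 :: real)"
      using exp_ge_add_one_self[of "1::real"] mult_mono[of 2 "exp (1::real)" 2 "exp (1::real)"]
      by (simp add: exp_add[symmetric])
    then have "4 powr n \<le> exp 2 powr n" using n by (intro powr_mono2) auto
    also have "\<dots> = exp (2 * n)" by (simp add: powr_def mult.commute)
    finally show ?thesis by (intro mult_mono) auto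
  qed
  also have "\<dots> = exp (- (7/2) * n)"
    unfolding exp_add[symmetric] r by (simp add: algebra_simps)
  also have "\<dots> \<le> exp (- 1)" using n by simp
  also have "\<dots> \<le> 1/2" using exp_ge_add_one_self[of "1::real"] by (simp add: exp_minus field_simps)
  finally show ?thesis
    using measure_pmf.prob_compl[of ?Q ?P] by (simp add: Compl_eq_Diff_UNIV)
qed

subsection \<open>Small ball probabilities\<close>

lemma lazy_rademacher_eq_diff:
  defines "H \<equiv> pmf_of_set {- (1/2), 1/2 :: real}"
  shows "lazy_rademacher = bind_pmf H (\<lambda>x. bind_pmf H (\<lambda>y. return_pmf (x - y)))"
proof (rule pmf_eqI)
  fix i :: real
  have "pmf (bind_pmf H (\<lambda>x. bind_pmf H (\<lambda>y. return_pmf (x - y)))) i = pmf lazy_rademacher i"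
    unfolding H_def lazy_rademacher_def pmf_bind pmf_pmf_of_list[OF lazy_rademacher_wf]
    by (simp add: integral_pmf_of_set indicator_def)
  then show "pmf lazy_rademacher i = pmf (bind_pmf H (\<lambda>x. bind_pmf H (\<lambda>y. return_pmf (x - y)))) i" ..
qed

lemma Pi_lazy_rademacher_eq_diff:
  assumes "finite J"
  defines "P \<equiv> Pi_pmf J 0 (\<lambda>_. pmf_of_set {- (1/2), 1/2 :: real})"
  shows "Pi_pmf J 0 (\<lambda>_. lazy_rademacher) = map_pmf (\<lambda>(f, g) j. f j - g j) (pair_pmf P P)"
proof -
  \<comment> \<open>Both copies have the default value 0 outside \<open>J\<close>, so their
    difference has it as well.\<close>
  have out: "f j = 0" if "f \<in> set_pmf P" "j \<notin> J" for f j
    using that by (auto simp: P_def dest!: subsetD[OF set_Pi_pmf_subset[OF assms(1)]])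
  have "Pi_pmf J 0 (\<lambda>_. lazy_rademacher) =
     bind_pmf P (\<lambda>f. bind_pmf P (\<lambda>g. return_pmf (\<lambda>j. if j \<in> J then f j - g j else 0)))"
    unfolding lazy_rademacher_eq_diff P_def
    by (simp only: Pi_pmf_bind[OF assms(1), where d' = 0] Pi_pmf_return_pmf[OF assms(1)])
  also have "\<dots> = bind_pmf P (\<lambda>f. bind_pmf P (\<lambda>g. return_pmf (\<lambda>j. f j - g j)))"
  proof (intro bind_pmf_cong refl arg_cong[of _ _ return_pmf])
    fix f g assume "f \<in> set_pmf P" "g \<in> set_pmf P"
    then show "(\<lambda>j. if j \<in> J then f j - g j else 0) = (\<lambda>j. f j - g j)"
      using out[of f] out[of g] by (auto simp: fun_eq_iff)
  qed
  also have "\<dots> = map_pmf (\<lambda>(f, g) j. f j - g j) (pair_pmf P P)"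
    by (simp add: pair_pmf_def map_bind_pmf)
  finally show ?thesis .
qed

text \<open>Half signs are centred and independent with variance 1/4. The induction conditions on
  the new coordinate, and the cross terms of its two values cancel.\<close>

lemma expectation_square_sum_half_signs:
  fixes a :: "'a \<Rightarrow> real"
  assumes "finite J"
  shows "measure_pmf.expectation (Pi_pmf J 0 (\<lambda>_. pmf_of_set {- (1/2), 1/2 :: real}))
           (\<lambda>h. (\<Sum>j\<in>J. h j * a j)\<^sup>2) = (\<Sum>j\<in>J. (a j)\<^sup>2) / 4"
  using assms
proof (induction J)
  case (insert x J)
  let ?H = "pmf_of_set {- (1/2), 1/2 :: real}"
  let ?P = "Pi_pmf J 0 (\<lambda>_. ?H)"
  have fin: "finite (set_pmf ?P)"
    using insert.hyps by (subst set_Pi_pmf) (auto intro!: finite_PiE_dflt)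
  have int: "integrable (measure_pmf ?P) g" for g :: "_ \<Rightarrow> real"
    by (rule integrable_measure_pmf_finite[OF fin])
  define Y where "Y h = (\<Sum>j\<in>J. h j * a j)" for h
  have upd: "(\<Sum>j\<in>insert x J. (h(x := y)) j * a j) = y * a x + Y h" for h y
  proof -
    have "(\<Sum>j\<in>J. (h(x := y)) j * a j) = Y h"
      unfolding Y_def using insert.hyps by (intro sum.cong) auto
    then show ?thesis using insert.hyps by simp
  qed
  have "Pi_pmf (insert x J) 0 (\<lambda>_. ?H) = bind_pmf ?H (\<lambda>y. map_pmf (\<lambda>h. h(x := y)) ?P)"
    using insert.hyps by (simp add: Pi_pmf_insert' map_pmf_def)
  then have "measure_pmf.expectation (Pi_pmf (insert x J) 0 (\<lambda>_. ?H)) (\<lambda>h. (\<Sum>j\<in>insert x J. h j * a j)\<^sup>2) =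
     (\<Sum>y\<in>{- (1/2), 1/2}. pmf ?H y *\<^sub>R
        measure_pmf.expectation (map_pmf (\<lambda>h. h(x := y)) ?P) (\<lambda>h. (\<Sum>j\<in>insert x J. h j * a j)\<^sup>2))"
    by (simp only:, subst pmf_expectation_bind[of "{- (1/2), 1/2}"]) (use fin in auto)
  also have "\<dots> = (\<Sum>y\<in>{- (1/2), 1/2}. 1/2 * measure_pmf.expectation ?P (\<lambda>h. (y * a x + Y h)\<^sup>2))"
    by (simp add: integral_map_pmf upd del: fun_upd_apply sum.insert)
  also have "\<dots> = measure_pmf.expectation ?P (\<lambda>h. 1/2 * (- 1/2 * a x + Y h)\<^sup>2 + 1/2 * (1/2 * a x + Y h)\<^sup>2)"
    by (simp add: int)
  also have "\<dots> = measure_pmf.expectation ?P (\<lambda>h. (a x)\<^sup>2 / 4 + (Y h)\<^sup>2)"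
    by (simp add: power2_eq_square algebra_simps)
  also have "\<dots> = (a x)\<^sup>2 / 4 + (\<Sum>j\<in>J. (a j)\<^sup>2) / 4"
    using insert.IH by (simp add: int Y_def)
  finally show ?case using insert.hyps by (simp add: add_divide_distrib)
qed simp

text \<open>Cauchy-Schwarz for the mean of \<open>w\<close>: the sum of the squared masses of
  \<open>Q\<close> is the probability that two independent copies coincide.\<close>

lemma expectation_le_collision_prob:
  fixes Q :: "'a pmf" and w :: "'a \<Rightarrow> real"
  assumes "finite (set_pmf Q)"
  shows "(measure_pmf.expectation Q w)\<^sup>2 \<le>
           measure_pmf.prob (pair_pmf Q Q) {(c, d). c = d} * (\<Sum>c\<in>set_pmf Q. (w c)\<^sup>2)"
proof -
  have "measure_pmf.expectation Q w = (\<Sum>c\<in>set_pmf Q. pmf Q c * w c)"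
    by (subst integral_measure_pmf[OF assms]) (auto simp: set_pmf_iff)
  then have "(measure_pmf.expectation Q w)\<^sup>2 \<le> (\<Sum>c\<in>set_pmf Q. (pmf Q c)\<^sup>2) * (\<Sum>c\<in>set_pmf Q. (w c)\<^sup>2)"
    by (simp add: Cauchy_Schwarz_ineq_sum)
  also have "(\<Sum>c\<in>set_pmf Q. (pmf Q c)\<^sup>2) = (\<Sum>p\<in>(\<lambda>c. (c, c)) ` set_pmf Q. pmf (pair_pmf Q Q) p)"
    by (subst sum.reindex) (auto simp: inj_on_def pmf_pair power2_eq_square)
  also have "\<dots> = measure_pmf.prob (pair_pmf Q Q) ((\<lambda>c. (c, c)) ` set_pmf Q)"
    using assms by (intro measure_measure_pmf_finite[symmetric]) auto
  also have "\<dots> \<le> measure_pmf.prob (pair_pmf Q Q) {(c, d). c = d}"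
    by (rule measure_pmf.finite_measure_mono) auto
  finally show ?thesis by (simp add: mult_right_mono sum_nonneg)
qed

text \<open>Jensen's inequality, obtained by integrating the tangent bound exp(a - Z) \<ge> 1 + a -
  Z.\<close>

lemma exp_minus_le_expectation:
  assumes "finite (set_pmf P)" "measure_pmf.expectation P Z \<le> a"
  shows "exp (- a) \<le> measure_pmf.expectation P (\<lambda>x. exp (- Z x :: real))"
proof -
  have int: "integrable (measure_pmf P) g" for g :: "_ \<Rightarrow> real"
    by (rule integrable_measure_pmf_finite[OF assms(1)])
  have "exp (- a) \<le> exp (- a) * (1 + a - measure_pmf.expectation P Z)"
    using assms(2) by simp
  also have "\<dots> = measure_pmf.expectation P (\<lambda>x. exp (- a) * (1 + a - Z x))"
    by (simp add: int)
  also have "\<dots> \<le> measure_pmf.expectation P (\<lambda>x. exp (- Z x))"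
  proof (rule integral_mono[OF int int])
    fix x
    have "1 + a - Z x \<le> exp (a - Z x)"
      using exp_ge_add_one_self[of "a - Z x"] by linarith
    then have "exp (- a) * (1 + a - Z x) \<le> exp (- a) * exp (a - Z x)"
      by (intro mult_left_mono) auto
    then show "exp (- a) * (1 + a - Z x) \<le> exp (- Z x)" by (simp add: exp_add[symmetric])
  qed
  finally show ?thesis .
qed

text \<open>The weight \<open>w\<close> has mean at least exp(-2) per functional, while its squares
  sum to at most the product of the \<open>2 * s k\<close>. Hence the floors collide with
  probability at least the product of exp(-4) / (2 s k), and 162 = 2 * 3^4 because e \<le>
  3.\<close>

theorem lazy_rademacher_small_ball:
  fixes \<alpha> :: "'k \<Rightarrow> 'j \<Rightarrow> real" and s :: "'k \<Rightarrow> real"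
  assumes fin: "finite J" "finite T"
    and s: "\<And>k. k \<in> T \<Longrightarrow> s k \<ge> 1"
    and \<alpha>: "\<And>k. k \<in> T \<Longrightarrow> L2_set (\<alpha> k) J \<le> s k"
  shows "measure_pmf.prob (Pi_pmf J 0 (\<lambda>_. lazy_rademacher)) {v. \<forall>k\<in>T. \<bar>\<Sum>j\<in>J. v j * \<alpha> k j\<bar> < 1}
           \<ge> (\<Prod>k\<in>T. 1 / (162 * s k))"
proof -
  define P where "P = Pi_pmf J 0 (\<lambda>_. pmf_of_set {- (1/2), 1/2 :: real})"
  have finP: "finite (set_pmf P)"
    unfolding P_def using fin by (subst set_Pi_pmf) (auto intro!: finite_PiE_dflt)
  have int: "integrable (measure_pmf P) g" for g :: "_ \<Rightarrow> real"
    by (rule integrable_measure_pmf_finite[OF finP])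
  define c where "c k h = (\<Sum>j\<in>J. h j * \<alpha> k j)" for k h
  define \<phi> where "\<phi> h = (\<lambda>k\<in>T. \<lfloor>c k h\<rfloor>)" for h
  define w where "w d = exp (- (\<Sum>k\<in>T. real_of_int \<bar>d k\<bar> / s k))" for d :: "'k \<Rightarrow> int"
  \<comment> \<open>\<open>Z\<close> dominates the exponent of the weight, by \<bar>floor c\<bar>
    \<le> \<bar>c\<bar> + 1, s \<ge> 1 and x \<le> (1 + x^2)/2. Being quadratic, it has a mean given
    by second moments.\<close>
  define Z where "Z h = (\<Sum>k\<in>T. 3/2 + (c k h)\<^sup>2 / (2 * (s k)\<^sup>2))" for h
  define Q where "Q = map_pmf \<phi> P"

  have "measure_pmf.expectation P Z =
      (\<Sum>k\<in>T. 3/2 + measure_pmf.expectation P (\<lambda>h. (c k h)\<^sup>2) / (2 * (s k)\<^sup>2))"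
    unfolding Z_def by (simp add: int)
  also have "\<dots> \<le> (\<Sum>k\<in>T. 2)"
  proof (rule sum_mono)
    fix k assume k: "k \<in> T"
    have "measure_pmf.expectation P (\<lambda>h. (c k h)\<^sup>2) = (L2_set (\<alpha> k) J)\<^sup>2 / 4"
      unfolding c_def P_def expectation_square_sum_half_signs[OF fin(1)]
      by (simp add: L2_set_def sum_nonneg)
    also have "\<dots> \<le> (s k)\<^sup>2 / 4" using \<alpha>[OF k] by (simp add: power_mono)
    also have "\<dots> \<le> (s k)\<^sup>2" by simp
    finally show "3/2 + measure_pmf.expectation P (\<lambda>h. (c k h)\<^sup>2) / (2 * (s k)\<^sup>2) \<le> 2"
      using s[OF k] by (simp add: field_simps)
  qed
  finally have EZ: "measure_pmf.expectation P Z \<le> 2 * real (card T)" by simp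

  have "exp (- (2 * real (card T))) \<le> measure_pmf.expectation P (\<lambda>h. exp (- Z h))"
    by (rule exp_minus_le_expectation[OF finP EZ])
  also have "\<dots> \<le> measure_pmf.expectation P (\<lambda>h. w (\<phi> h))"
  proof (rule integral_mono[OF int int])
    fix h
    have "(\<Sum>k\<in>T. real_of_int \<bar>\<phi> h k\<bar> / s k) \<le> Z h"
      unfolding Z_def
    proof (rule sum_mono)
      fix k assume k: "k \<in> T"
      have "real_of_int \<bar>\<phi> h k\<bar> / s k \<le> (\<bar>c k h\<bar> + 1) / s k"
      proof (rule divide_right_mono)
        have "\<bar>\<lfloor>c k h\<rfloor>\<bar> \<le> \<bar>c k h\<bar> + 1" by linarith
        then show "real_of_int \<bar>\<phi> h k\<bar> \<le> \<bar>c k h\<bar> + 1" using k by (simp add: \<phi>_def)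
      qed (use s[OF k] in simp)
      also have "\<dots> = \<bar>c k h / s k\<bar> + 1 / s k" using s[OF k] by (simp add: add_divide_distrib)
      also have "\<dots> \<le> \<bar>c k h / s k\<bar> + 1" using s[OF k] by simp
      also have "\<dots> \<le> 3/2 + (c k h / s k)\<^sup>2 / 2"
        using sum_squares_bound[of "\<bar>c k h / s k\<bar>" 1] by (simp del: abs_divide)
      finally show "real_of_int \<bar>\<phi> h k\<bar> / s k \<le> 3/2 + (c k h)\<^sup>2 / (2 * (s k)\<^sup>2)"
        by (simp add: power_divide)
    qed
    then show "exp (- Z h) \<le> w (\<phi> h)" by (simp add: w_def)
  qed
  also have "\<dots> = measure_pmf.expectation Q w"
    by (simp add: Q_def)
  finally have "(exp (- (2 * real (card T))))\<^sup>2 \<le> (measure_pmf.expectation Q w)\<^sup>2"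
    by (intro power_mono) auto
  also have "(exp (- (2 * real (card T))))\<^sup>2 = exp (- 4) ^ card T"
    by (simp add: power2_eq_square exp_add[symmetric] exp_of_nat_mult[symmetric])
  also have "(measure_pmf.expectation Q w)\<^sup>2 \<le>
      measure_pmf.prob (pair_pmf Q Q) {(c, d). c = d} * (\<Sum>d\<in>set_pmf Q. (w d)\<^sup>2)"
    by (rule expectation_le_collision_prob) (simp add: Q_def finP)
  also have "\<dots> \<le> measure_pmf.prob (pair_pmf Q Q) {(c, d). c = d} * (\<Prod>k\<in>T. 2 * s k)"
  proof (rule mult_left_mono)
    define R where "R k = (\<lambda>h. \<lfloor>c k h\<rfloor>) ` set_pmf P" for k
    have "(\<Sum>d\<in>set_pmf Q. (w d)\<^sup>2) = (\<Sum>d\<in>set_pmf Q. \<Prod>k\<in>T. exp (- 2 * real_of_int \<bar>d k\<bar> / s k))"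
    proof (rule sum.cong[OF refl])
      fix d
      have "(w d)\<^sup>2 = exp (\<Sum>k\<in>T. - 2 * real_of_int \<bar>d k\<bar> / s k)"
        by (simp add: w_def power2_eq_square exp_add[symmetric] sum_negf sum_distrib_left)
      also have "\<dots> = (\<Prod>k\<in>T. exp (- 2 * real_of_int \<bar>d k\<bar> / s k))"
        by (rule exp_sum[OF fin(2)])
      finally show "(w d)\<^sup>2 = \<dots>" .
    qed
    \<comment> \<open>Enlarging the range of \<open>\<phi>\<close> to a full product makes the sum
      factorise; \<open>\<phi>\<close> is restricted to \<open>T\<close> so that its values lie in
      \<open>PiE\<close>.\<close>
    also have "\<dots> \<le> (\<Sum>d\<in>PiE T R. \<Prod>k\<in>T. exp (- 2 * real_of_int \<bar>d k\<bar> / s k))"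
    proof (rule sum_mono2)
      show "set_pmf Q \<subseteq> PiE T R" by (auto simp: Q_def \<phi>_def R_def)
    qed (use fin finP in \<open>auto simp: R_def intro!: finite_PiE prod_nonneg\<close>)
    also have "\<dots> = (\<Prod>k\<in>T. \<Sum>d\<in>R k. exp (- 2 * real_of_int \<bar>d\<bar> / s k))"
      by (rule prod_sum_PiE[symmetric]) (use fin finP in \<open>auto simp: R_def\<close>)
    also have "\<dots> \<le> (\<Prod>k\<in>T. 2 * s k)"
      by (intro prod_mono conjI sum_nonneg sum_exp_abs_int_le s) (use finP in \<open>auto simp: R_def\<close>)
    finally show "(\<Sum>d\<in>set_pmf Q. (w d)\<^sup>2) \<le> (\<Prod>k\<in>T. 2 * s k)" .
  qed simp
  also have "measure_pmf.prob (pair_pmf Q Q) {(c, d). c = d} =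
      measure_pmf.prob (pair_pmf P P) {(f, g). \<phi> f = \<phi> g}"
    unfolding Q_def map_pair[symmetric] measure_map_pmf
    by (rule arg_cong[of _ _ "measure_pmf.prob _"]) auto
  also have "\<dots> \<le> measure_pmf.prob (Pi_pmf J 0 (\<lambda>_. lazy_rademacher)) {v. \<forall>k\<in>T. \<bar>\<Sum>j\<in>J. v j * \<alpha> k j\<bar> < 1}"
    unfolding Pi_lazy_rademacher_eq_diff[OF fin(1)] P_def[symmetric] measure_map_pmf
  proof (rule measure_pmf.finite_measure_mono)
    show "{(f, g). \<phi> f = \<phi> g} \<subseteq>
        (\<lambda>(f, g) j. f j - g j) -` {v. \<forall>k\<in>T. \<bar>\<Sum>j\<in>J. v j * \<alpha> k j\<bar> < 1}"
    proof clarsimp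
      fix f g k assume eq: "\<phi> f = \<phi> g" and k: "k \<in> T"
      have "\<lfloor>c k f\<rfloor> = \<lfloor>c k g\<rfloor>" using fun_cong[OF eq, of k] k by (simp add: \<phi>_def)
      then have "\<bar>c k f - c k g\<bar> < 1" by linarith
      then show "\<bar>\<Sum>j\<in>J. (f j - g j) * \<alpha> k j\<bar> < 1"
        by (simp add: c_def left_diff_distrib sum_subtractf)
    qed
  qed simp
  finally have main: "exp (- 4) ^ card T \<le>
     measure_pmf.prob (Pi_pmf J 0 (\<lambda>_. lazy_rademacher)) {v. \<forall>k\<in>T. \<bar>\<Sum>j\<in>J. v j * \<alpha> k j\<bar> < 1} * (\<Prod>k\<in>T. 2 * s k)"
    by (simp add: mult_right_mono prod_nonneg s order_trans[OF zero_le_one])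
  have "exp 4 = exp (1 :: real) ^ 4" by (simp add: exp_of_nat_mult[symmetric])
  also have "\<dots> \<le> 3 ^ 4" using exp_le by (intro power_mono) auto
  finally have e: "1 / 81 \<le> exp (- 4 :: real)" by (simp add: exp_minus field_simps)
  have pos: "(\<Prod>k\<in>T. 2 * s k) > 0"
    by (intro prod_pos) (use s in force)
  have "(\<Prod>k\<in>T. 1 / (162 * s k)) = (1 / 81) ^ card T / (\<Prod>k\<in>T. 2 * s k)"
    by (simp add: prod_dividef prod.distrib power_mult_distrib[symmetric] field_simps)
  also have "\<dots> \<le> exp (- 4) ^ card T / (\<Prod>k\<in>T. 2 * s k)"
    using e pos by (intro divide_right_mono power_mono) auto
  also have "\<dots> \<le> measure_pmf.prob (Pi_pmf J 0 (\<lambda>_. lazy_rademacher)) {v. \<forall>k\<in>T. \<bar>\<Sum>j\<in>J. v j * \<alpha> k j\<bar> < 1}"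
    using main pos by (simp add: field_simps)
  finally show ?thesis .
qed

subsection \<open>The smallest singular value\<close>

text \<open>The dimension is not a type, so vectors are functions vanishing from \<open>n\<close>
  on. The sphere is then closed in a product of compact sets, compact by Tychonoff.\<close>

lemma compact_sphere_fun:
  "compact {x :: nat \<Rightarrow> real. (\<forall>i\<ge>n. x i = 0) \<and> (\<Sum>i<n. (x i)\<^sup>2) = 1}"
proof -
  define X where "X = (\<Pi>\<^sub>E i\<in>(UNIV :: nat set). if i < n then {-1..1} else {0 :: real})"
  have "compactin (product_topology (\<lambda>_ :: nat. euclidean :: real topology) UNIV) X"
    unfolding X_def compactin_PiE by (auto simp: compactin_euclidean_iff)
  then have X: "compact X"
    by (simp add: euclidean_product_topology compactin_euclidean_iff)
  have "{x :: nat \<Rightarrow> real. (\<forall>i\<ge>n. x i = 0) \<and> (\<Sum>i<n. (x i)\<^sup>2) = 1} =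
      X \<inter> {x. (\<Sum>i<n. (x i)\<^sup>2) = 1}"
  proof (intro Set.set_eqI iffI)
    fix x :: "nat \<Rightarrow> real"
    assume x: "x \<in> {x. (\<forall>i\<ge>n. x i = 0) \<and> (\<Sum>i<n. (x i)\<^sup>2) = 1}"
    have "x i \<in> {-1..1}" if "i < n" for i
    proof -
      have "(x i)\<^sup>2 \<le> (\<Sum>i<n. (x i)\<^sup>2)" using that by (intro member_le_sum) auto
      then have "\<bar>x i\<bar> \<le> 1" using x by (simp add: abs_square_le_1)
      then show ?thesis by auto
    qed
    then show "x \<in> X \<inter> {x. (\<Sum>i<n. (x i)\<^sup>2) = 1}" using x by (auto simp: X_def)
  next
    fix x :: "nat \<Rightarrow> real"
    assume x: "x \<in> X \<inter> {x. (\<Sum>i<n. (x i)\<^sup>2) = 1}"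
    have "x i = 0" if "i \<ge> n" for i
    proof -
      have "x \<in> X" using x by blast
      from PiE_mem[OF this[unfolded X_def] UNIV_I]
      have "x i \<in> (if i < n then {-1..1} else {0})" .
      then show ?thesis using that by simp
    qed
    then show "x \<in> {x. (\<forall>i\<ge>n. x i = 0) \<and> (\<Sum>i<n. (x i)\<^sup>2) = 1}" using x by auto
  qed
  moreover have "closed {x :: nat \<Rightarrow> real. (\<Sum>i<n. (x i)\<^sup>2) = 1}"
    by (intro closed_Collect_eq continuous_intros continuous_on_product_coordinates)
  ultimately show ?thesis using X by (simp add: compact_Int_closed)
qed

text \<open>First-order condition at a minimum: for b \<noteq> 0 a small step against the sign of b
  makes the expression negative.\<close>

lemma linear_coeff_zero_of_quadratic_nonneg:
  fixes b c :: real
  assumes "\<And>e. 2 * e * b + e\<^sup>2 * c \<ge> 0"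
  shows "b = 0"
proof (rule ccontr)
  assume b: "b \<noteq> 0"
  define d where "d = \<bar>c\<bar> + 1"
  have d: "d > 0" "c < 2 * d" by (auto simp: d_def)
  have "0 \<le> 2 * (- b / d) * b + (- b / d)\<^sup>2 * c" by (rule assms)
  also have "\<dots> = (b\<^sup>2 / d\<^sup>2) * (c - 2 * d)"
    using d by (simp add: field_simps power2_eq_square)
  also have "\<dots> < 0" using b d by (intro mult_pos_neg) auto
  finally show False by simp
qed

text \<open>The squared length of \<open>Q\<close> z is minimised over the unit sphere. Stationarity
  makes the minimum \<open>m\<close> an eigenvalue of the Gram matrix, so the least singular value
  is at most sqrt m, and by homogeneity sqrt m is at most the length of \<open>Q\<close> x.\<close>

theorem smallest_singular_value_le:
  fixes Q :: "real mat"
  assumes Q: "Q \<in> carrier_mat n n" and x: "L2_set x {..<n} \<ge> 1"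
  shows "smallest_singular_value Q \<le> L2_set (\<lambda>i. \<Sum>j<n. Q $$ (i, j) * x j) {..<n}"
proof -
  have n: "n > 0" using x by (cases n) auto
  define g where "g y i = (\<Sum>j<n. Q $$ (i, j) * y j)" for y i
  define q where "q y = (\<Sum>i<n. (g y i)\<^sup>2)" for y
  define N where "N y = (\<Sum>i<n. (y i)\<^sup>2)" for y :: "nat \<Rightarrow> real"
  define U where "U = {x :: nat \<Rightarrow> real. (\<forall>i\<ge>n. x i = 0) \<and> (\<Sum>i<n. (x i)\<^sup>2) = 1}"
  have "(\<lambda>i. if i = 0 then 1 else 0) \<in> U"
    using n by (simp add: U_def if_distrib[of "\<lambda>a. a\<^sup>2"] sum.delta cong: if_cong)
  moreover have "continuous_on U q"
    unfolding q_def g_def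
    by (intro continuous_intros continuous_on_subset[OF continuous_on_product_coordinates subset_UNIV])
  ultimately obtain z where z: "z \<in> U" "\<And>y. y \<in> U \<Longrightarrow> q z \<le> q y"
    using continuous_attains_inf[of U q] compact_sphere_fun[of n, folded U_def] by blast
  define m where "m = q z"
  have m0: "m \<ge> 0" by (simp add: m_def q_def sum_nonneg)
  have ray: "m * N y \<le> q y" for y
  proof (cases "N y = 0")
    case True
    then show ?thesis by (simp add: q_def sum_nonneg)
  next
    case False
    define c where "c = sqrt (N y)"
    have N: "N y \<ge> 0" by (simp add: N_def sum_nonneg)
    have c: "c > 0" "c\<^sup>2 = N y" using False N by (simp_all add: c_def less_le)
    define u where "u i = (if i < n then y i / c else 0)" for i
    have "N u = N y / c\<^sup>2"
      by (simp add: N_def u_def power_divide sum_divide_distrib)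
    then have "u \<in> U" using c False unfolding U_def N_def[symmetric] by (simp add: u_def)
    then have "m \<le> q u" unfolding m_def by (rule z)
    also have "q u = q y / c\<^sup>2"
    proof -
      have "g u i = g y i / c" for i
        by (simp add: g_def u_def sum_divide_distrib)
      then show ?thesis by (simp add: q_def power_divide sum_divide_distrib)
    qed
    finally have "m \<le> q y / N y" using c by simp
    moreover have "N y > 0" using False N by simp
    ultimately show ?thesis by (simp add: pos_le_divide_eq)
  qed
  \<comment> \<open>The first variation of \<open>q - m * N\<close> at its zero \<open>z\<close> in
    the k-th coordinate direction gives the k-th coordinate of the eigenvector equation.\<close>
  have stat: "(\<Sum>i<n. g z i * Q $$ (i, k)) = m * z k" if k: "k < n" for k
  proof -
    define e where "e = (\<lambda>i. if i = k then 1 else 0 :: real)"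
    have ge: "g e i = Q $$ (i, k)" for i
      using k by (simp add: g_def e_def if_distrib sum.delta cong: if_cong)
    have ze: "(\<Sum>i<n. z i * e i) = z k"
      using k by (simp add: e_def if_distrib sum.delta cong: if_cong)
    have Nz: "N z = 1" using z by (simp add: U_def N_def)
    have "(\<Sum>i<n. g z i * g e i) - m * (\<Sum>i<n. z i * e i) = 0"
    proof (rule linear_coeff_zero_of_quadratic_nonneg[where c = "q e - m * N e"])
      fix t :: real
      have "g (\<lambda>i. z i + t * e i) i = g z i + t * g e i" for i
        by (simp add: g_def sum_distrib_left sum.distrib algebra_simps)
      then have "q (\<lambda>i. z i + t * e i) = q z + 2 * t * (\<Sum>i<n. g z i * g e i) + t\<^sup>2 * q e"
        by (simp add: q_def sum_distrib_left sum.distrib algebra_simps power2_eq_square)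
      moreover have "N (\<lambda>i. z i + t * e i) = N z + 2 * t * (\<Sum>i<n. z i * e i) + t\<^sup>2 * N e"
        by (simp add: N_def sum_distrib_left sum.distrib algebra_simps power2_eq_square)
      ultimately show "2 * t * ((\<Sum>i<n. g z i * g e i) - m * (\<Sum>i<n. z i * e i)) + t\<^sup>2 * (q e - m * N e) \<ge> 0"
        using ray[of "\<lambda>i. z i + t * e i"] by (simp add: Nz m_def algebra_simps)
    qed
    then show ?thesis by (simp add: ge ze)
  qed
  define A where "A = transpose_mat Q * Q"
  have A: "A \<in> carrier_mat n n" using Q by (simp add: A_def)
  have dim: "dim_row Q = n" "dim_col Q = n" using Q by auto
  have "eigenvector A (Matrix.vec n z) m"
    unfolding eigenvector_def
  proof (intro conjI)
    show "Matrix.vec n z \<in> carrier_vec (dim_row A)" using A by simp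
    show "Matrix.vec n z \<noteq> 0\<^sub>v (dim_row A)"
    proof
      assume "Matrix.vec n z = 0\<^sub>v (dim_row A)"
      then have "z i = 0" if "i < n" for i
        using A that by (metis carrier_matD(1) index_vec index_zero_vec(1))
      then show False using z by (simp add: U_def)
    qed
    have Qz: "Q *\<^sub>v Matrix.vec n z = Matrix.vec n (g z)"
      by (rule eq_vecI) (auto simp: dim scalar_prod_def g_def lessThan_atLeast0)
    have "A *\<^sub>v Matrix.vec n z = transpose_mat Q *\<^sub>v (Q *\<^sub>v Matrix.vec n z)"
      unfolding A_def by (rule assoc_mult_mat_vec) (use Q in auto)
    also have "\<dots> = m \<cdot>\<^sub>v Matrix.vec n z"
      unfolding Qz using stat
      by (intro eq_vecI) (auto simp: dim scalar_prod_def lessThan_atLeast0 mult.commute)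
    finally show "A *\<^sub>v Matrix.vec n z = m \<cdot>\<^sub>v Matrix.vec n z" .
  qed
  then have "eigenvalue A m" unfolding eigenvalue_def by blast
  then have "sqrt m \<in> singular_values Q" by (auto simp: singular_values_def A_def)
  moreover have "finite (singular_values Q)"
    using card_finite_spectrum(1)[OF A] by (simp add: singular_values_def A_def spectrum_def)
  ultimately have "smallest_singular_value Q \<le> sqrt m"
    by (simp add: smallest_singular_value_def)
  also have "\<dots> \<le> sqrt (q x)"
  proof (rule real_sqrt_le_mono)
    have "1 \<le> sqrt (N x)" using x by (simp add: L2_set_def N_def)
    then have "1 \<le> N x" by simp
    then have "m * 1 \<le> m * N x" using m0 by (intro mult_left_mono)
    then show "m \<le> q x" using ray[of x] by simp
  qed
  finally show ?thesis by (simp add: L2_set_def q_def g_def)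
qed

text \<open>Conditioning on the first component: the second event may depend on \<open>x\<close>, as
  the event for the last row depends on the rows above it.\<close>

lemma prob_pair_pmf_ge:
  fixes P :: "'a pmf" and Q :: "'b pmf"
  assumes fin: "finite (set_pmf P)" "finite (set_pmf Q)"
    and A: "measure_pmf.prob P A \<ge> a" and b: "b \<ge> 0"
    and B: "\<And>x. x \<in> A \<Longrightarrow> x \<in> set_pmf P \<Longrightarrow> measure_pmf.prob Q (B x) \<ge> b"
  shows "measure_pmf.prob (pair_pmf P Q) {(x, y). x \<in> A \<and> y \<in> B x} \<ge> a * b"
proof -
  let ?E = "{(x, y). x \<in> A \<and> y \<in> B x}"
  have pair: "pair_pmf P Q = bind_pmf P (\<lambda>x. map_pmf (Pair x) Q)"
    by (simp add: pair_pmf_def map_pmf_def)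
  have "a * b \<le> measure_pmf.prob P (A \<inter> set_pmf P) * b"
    using A b by (simp add: measure_Int_set_pmf mult_right_mono)
  also have "measure_pmf.prob P (A \<inter> set_pmf P) = (\<Sum>x\<in>A \<inter> set_pmf P. pmf P x)"
    using fin by (simp add: measure_measure_pmf_finite)
  also have "\<dots> * b = (\<Sum>x\<in>A \<inter> set_pmf P. pmf P x * b)"
    by (rule sum_distrib_right)
  also have "\<dots> \<le> (\<Sum>x\<in>A \<inter> set_pmf P. pmf P x * measure_pmf.prob Q (Pair x -` ?E))"
  proof (intro sum_mono mult_left_mono)
    fix x assume x: "x \<in> A \<inter> set_pmf P"
    then have "Pair x -` ?E = B x" by auto
    then show "b \<le> measure_pmf.prob Q (Pair x -` ?E)" using B x by simp
  qed simp
  also have "\<dots> \<le> (\<Sum>x\<in>set_pmf P. pmf P x * measure_pmf.prob Q (Pair x -` ?E))"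
    using fin by (intro sum_mono2) auto
  also have "\<dots> = (\<Sum>x\<in>set_pmf P. pmf P x *\<^sub>R measure_pmf.expectation (map_pmf (Pair x) Q) (indicator ?E))"
    by (simp add: measure_map_pmf)
  also have "\<dots> = measure_pmf.expectation (pair_pmf P Q) (indicator ?E)"
    unfolding pair by (rule pmf_expectation_bind[symmetric]) (use fin in auto)
  also have "\<dots> = measure_pmf.prob (pair_pmf P Q) ?E" by simp
  finally show ?thesis .
qed

section \<open>Krylov vectors and the truncated Neumann series\<close>

text \<open>This is R'^k u, for R' the top left m by m block of \<open>h\<close> and u the first m
  entries of the column with index m.\<close>

fun krylov :: "nat \<Rightarrow> (nat \<times> nat \<Rightarrow> real) \<Rightarrow> nat \<Rightarrow> nat \<Rightarrow> real" where
  "krylov m h 0 = (\<lambda>i. h (i, m))"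
| "krylov m h (Suc k) = (\<lambda>i. \<Sum>j<m. h (i, j) * krylov m h k j)"

text \<open>The terms p \<le> k < q of the Neumann series of (L I + R')^-1 u.\<close>

definition resolvent_tail :: "nat \<Rightarrow> (nat \<times> nat \<Rightarrow> real) \<Rightarrow> real \<Rightarrow> nat \<Rightarrow> nat \<Rightarrow> nat \<Rightarrow> real" where
  "resolvent_tail m h L p q j = (\<Sum>k=p..<q. (-1) ^ k * krylov m h k j / L ^ Suc k)"

text \<open>Only the rows above row m enter, so these vectors may be computed from the upper block
  before the last row is drawn.\<close>

lemma krylov_cong:
  assumes "\<And>i j. i < m \<Longrightarrow> j \<le> m \<Longrightarrow> h (i, j) = h' (i, j)" and "i < m"
  shows "krylov m h k i = krylov m h' k i"
  using assms(2)
proof (induction k arbitrary: i)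
  case (Suc k)
  then show ?case by (auto intro!: sum.cong simp: assms(1))
qed (simp add: assms(1))

lemma L2_set_krylov_le:
  assumes op: "\<And>x. L2_set (\<lambda>i. \<Sum>j<m. h (i, j) * x j) {..<m} \<le> \<kappa> * L2_set x {..<m}"
    and \<kappa>: "\<kappa> \<ge> 0" and r: "L2_set (\<lambda>i. h (i, m)) {..<m} \<le> r"
  shows "L2_set (krylov m h k) {..<m} \<le> \<kappa> ^ k * r"
proof (induction k)
  case (Suc k)
  have "L2_set (krylov m h (Suc k)) {..<m} \<le> \<kappa> * L2_set (krylov m h k) {..<m}"
    using op[of "krylov m h k"] by simp
  also have "\<dots> \<le> \<kappa> * (\<kappa> ^ k * r)" using Suc \<kappa> by (rule mult_left_mono)
  finally show ?case by (simp add: mult.assoc)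
qed (use r in simp)

lemma L2_set_sum_le: "L2_set (\<lambda>j. \<Sum>k\<in>S. f k j) A \<le> (\<Sum>k\<in>S. L2_set (f k) A)"
proof (induction S rule: infinite_finite_induct)
  case (insert k S)
  have "L2_set (\<lambda>j. f k j + (\<Sum>k\<in>S. f k j)) A \<le> L2_set (f k) A + L2_set (\<lambda>j. \<Sum>k\<in>S. f k j) A"
    by (rule L2_set_triangle_ineq)
  then show ?case using insert by simp
qed (simp_all add: L2_set_def)

text \<open>A geometric series with ratio \<kappa>/L \<le> 1/2, whence the factor 2; the bound is
  uniform in the truncation \<open>q\<close>.\<close>

lemma L2_set_resolvent_tail_le:
  assumes kry: "\<And>k. L2_set (krylov m h k) {..<m} \<le> \<kappa> ^ k * r"
    and r: "r \<ge> 0" and \<kappa>: "0 \<le> \<kappa>" "2 * \<kappa> \<le> L" and L: "L > 0"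
  shows "L2_set (resolvent_tail m h L p q) {..<m} \<le> 2 * r / L * (\<kappa> / L) ^ p"
proof (cases "p \<le> q")
  case True
  have "L2_set (resolvent_tail m h L p q) {..<m} \<le>
      (\<Sum>k=p..<q. L2_set (\<lambda>j. (-1) ^ k * krylov m h k j / L ^ Suc k) {..<m})"
    unfolding resolvent_tail_def by (rule L2_set_sum_le)
  also have "\<dots> \<le> (\<Sum>k=p..<q. r / L * (\<kappa> / L) ^ k)"
  proof (rule sum_mono)
    fix k
    have "L2_set (\<lambda>j. (-1) ^ k * krylov m h k j / L ^ Suc k) {..<m} =
        \<bar>(-1) ^ k / L ^ Suc k\<bar> * L2_set (krylov m h k) {..<m}"
      unfolding L2_set_scale[symmetric] by simp
    also have "\<dots> \<le> \<bar>(-1) ^ k / L ^ Suc k\<bar> * (\<kappa> ^ k * r)"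
      by (intro mult_left_mono kry) simp
    also have "\<dots> = r / L * (\<kappa> / L) ^ k"
      using L by (simp add: abs_divide power_abs power_divide)
    finally show "L2_set (\<lambda>j. (-1) ^ k * krylov m h k j / L ^ Suc k) {..<m} \<le> r / L * (\<kappa> / L) ^ k" .
  qed
  also have "\<dots> = r / L * (\<kappa> / L) ^ p * (\<Sum>i<q - p. (\<kappa> / L) ^ i)"
  proof -
    have "(\<Sum>k=p..<q. (\<kappa> / L) ^ k) = (\<Sum>i<q - p. (\<kappa> / L) ^ (i + p))"
      using True sum.shift_bounds_nat_ivl[of "\<lambda>k. (\<kappa> / L) ^ k" 0 p "q - p"] by (simp add: lessThan_atLeast0)
    also have "\<dots> = (\<kappa> / L) ^ p * (\<Sum>i<q - p. (\<kappa> / L) ^ i)"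
      by (simp only: power_add sum_distrib_left mult.commute)
    finally show ?thesis
      by (simp only: sum_distrib_left[symmetric] mult.assoc)
  qed
  also have "\<dots> \<le> r / L * (\<kappa> / L) ^ p * 2"
  proof (rule mult_left_mono)
    have le: "\<kappa> / L \<le> 1/2" "\<kappa> / L \<ge> 0" using \<kappa> L by (simp_all add: field_simps)
    have "(\<Sum>i<q - p. (\<kappa> / L) ^ i) \<le> (\<Sum>i<q - p. (1/2) ^ i)"
      using le by (intro sum_mono power_mono)
    also have "\<dots> \<le> (\<Sum>i. (1/2) ^ i :: real)"
      by (intro sum_le_suminf summable_geometric) auto
    also have "\<dots> = 2" by (subst suminf_geometric) auto
    finally show "(\<Sum>i<q - p. (\<kappa> / L) ^ i) \<le> 2" .
  qed (use r L \<kappa> in simp)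
  finally show ?thesis by (simp add: mult_ac)
next
  case False
  then show ?thesis using r \<kappa> L by (simp add: resolvent_tail_def[abs_def] L2_set_def)
qed

text \<open>
  The bordered matrix is tested against \<open>(- (L I + R')\<^sup>-\<^sup>1 u, 1)\<close>, with the Neumann series of the
  inverse truncated at \<open>M\<close> terms; the top block of the image telescopes.
\<close>

lemma smallest_singular_value_bordered_le:
  fixes h :: "nat \<times> nat \<Rightarrow> real"
  assumes kry: "L2_set (krylov m h M) {..<m} \<le> \<kappa> ^ M * r"
    and \<kappa>: "0 \<le> \<kappa>" "2 * \<kappa> \<le> L" and L: "L > 0" and r: "r \<ge> 0"
    and corner: "h (m, m) = 0"
    and orth: "\<And>k. k < p \<Longrightarrow> (\<Sum>j<m. h (m, j) * krylov m h k j) = 0"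
    and tail: "\<bar>\<Sum>j<m. h (m, j) * resolvent_tail m h L p M j\<bar> \<le> \<sigma>"
    and pM: "p \<le> M"
  shows "smallest_singular_value (diag_L0 (Suc m) L + Matrix.mat (Suc m) (Suc m) h) \<le> r * (1/2) ^ M + \<sigma>"
proof -
  define Q where "Q = diag_L0 (Suc m) L + Matrix.mat (Suc m) (Suc m) h"
  define x where "x j = (if j < m then - resolvent_tail m h L 0 M j else 1)" for j
  have Q: "Q \<in> carrier_mat (Suc m) (Suc m)" by (simp add: Q_def diag_L0_def)
  have Qij: "Q $$ (i, j) = (if i = j \<and> i < m then L else 0) + h (i, j)" if "i < Suc m" "j < Suc m" for i j
    using that by (simp add: Q_def diag_L0_def mat_diag_def)
  have top: "(\<Sum>j<Suc m. Q $$ (i, j) * x j) = (-1) ^ M * krylov m h M i / L ^ M" if i: "i < m" for i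
  proof -
    define b where "b k = (-1) ^ k * krylov m h k i / L ^ k" for k
    have "(\<Sum>j<Suc m. Q $$ (i, j) * x j) =
        (\<Sum>j<m. (if i = j then L else 0) * x j) + (\<Sum>j<m. h (i, j) * x j) + h (i, m)"
    proof -
      have "(\<Sum>j<m. Q $$ (i, j) * x j) = (\<Sum>j<m. (if i = j then L else 0) * x j + h (i, j) * x j)"
        using i by (intro sum.cong) (auto simp: Qij distrib_right)
      then show ?thesis
        unfolding sum.lessThan_Suc sum.distrib using i by (simp add: Qij x_def)
    qed
    also have "(\<Sum>j<m. (if i = j then L else 0) * x j) = L * x i"
      using i by (simp add: if_distrib[of "\<lambda>a. a * _"] sum.delta cong: if_cong)
    also have "L * x i = - (\<Sum>k<M. b k)"
      using i L by (simp add: x_def resolvent_tail_def b_def sum_distrib_left lessThan_atLeast0 mult.commute)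
    also have "(\<Sum>j<m. h (i, j) * x j) = (\<Sum>k<M. b (Suc k))"
    proof -
      have "(\<Sum>j<m. h (i, j) * x j) = - (\<Sum>j<m. \<Sum>k<M. h (i, j) * ((-1) ^ k * krylov m h k j / L ^ Suc k))"
        by (simp add: x_def resolvent_tail_def sum_distrib_left lessThan_atLeast0 sum_negf)
      also have "\<dots> = - (\<Sum>k<M. \<Sum>j<m. h (i, j) * ((-1) ^ k * krylov m h k j / L ^ Suc k))"
        by (subst sum.swap) simp
      also have "\<dots> = (\<Sum>k<M. b (Suc k))"
        by (simp add: b_def sum_distrib_left sum_divide_distrib sum_negf mult_ac)
      finally show ?thesis .
    qed
    also have "- (\<Sum>k<M. b k) + (\<Sum>k<M. b (Suc k)) = b M - b 0"
      using sum_lessThan_telescope[of b M] by (simp add: sum_subtractf)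
    also have "b M - b 0 + h (i, m) = b M" by (simp add: b_def)
    finally show ?thesis by (simp add: b_def)
  qed
  \<comment> \<open>The first p terms of the series are orthogonal to the last row and the corner
    entry is 0, so only the tail remains.\<close>
  have bottom: "(\<Sum>j<Suc m. Q $$ (m, j) * x j) = - (\<Sum>j<m. h (m, j) * resolvent_tail m h L p M j)"
  proof -
    have split: "resolvent_tail m h L 0 M j = resolvent_tail m h L 0 p j + resolvent_tail m h L p M j" for j
      unfolding resolvent_tail_def using pM by (simp add: sum.atLeastLessThan_concat)
    have "(\<Sum>j<m. h (m, j) * resolvent_tail m h L 0 p j) =
        (\<Sum>k=0..<p. \<Sum>j<m. h (m, j) * ((-1) ^ k * krylov m h k j / L ^ Suc k))"
      unfolding resolvent_tail_def sum_distrib_left by (rule sum.swap)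
    also have "\<dots> = (\<Sum>k=0..<p. (-1) ^ k / L ^ Suc k * (\<Sum>j<m. h (m, j) * krylov m h k j))"
      by (simp add: sum_distrib_left mult_ac)
    also have "\<dots> = 0" using orth by simp
    finally have "(\<Sum>j<m. h (m, j) * resolvent_tail m h L 0 p j) = 0" .
    then have "(\<Sum>j<m. h (m, j) * resolvent_tail m h L 0 M j) = (\<Sum>j<m. h (m, j) * resolvent_tail m h L p M j)"
      by (simp add: split distrib_left sum.distrib)
    then show ?thesis
      by (simp add: Qij x_def corner sum_negf)
  qed
  \<comment> \<open>The last coordinate 1 of the test vector already makes its norm at least
    1.\<close>
  have "1 \<le> L2_set x {..<Suc m}"
    using member_le_L2_set[of "{..<Suc m}" m x] by (simp add: x_def)
  from smallest_singular_value_le[OF Q this]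
  have "smallest_singular_value Q \<le> L2_set (\<lambda>i. \<Sum>j<Suc m. Q $$ (i, j) * x j) (insert m {..<m})"
    by (simp only: lessThan_Suc)
  also have "\<dots> \<le> \<bar>\<Sum>j<Suc m. Q $$ (m, j) * x j\<bar> + L2_set (\<lambda>i. \<Sum>j<Suc m. Q $$ (i, j) * x j) {..<m}"
    by (subst L2_set_insert)
      (auto intro!: order_trans[OF sqrt_sum_squares_le_sum_abs] simp del: sum.lessThan_Suc)
  also have "\<bar>\<Sum>j<Suc m. Q $$ (m, j) * x j\<bar> \<le> \<sigma>"
    unfolding bottom using tail by simp
  also have "L2_set (\<lambda>i. \<Sum>j<Suc m. Q $$ (i, j) * x j) {..<m} = L2_set (\<lambda>i. (-1) ^ M / L ^ M * krylov m h M i) {..<m}"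
    by (rule L2_set_cong[OF refl]) (simp add: top del: sum.lessThan_Suc)
  also have "\<dots> = L2_set (krylov m h M) {..<m} / L ^ M"
    using L by (simp only: L2_set_scale) (simp add: abs_divide power_abs)
  also have "\<dots> \<le> \<kappa> ^ M * r / L ^ M" using kry L by (intro divide_right_mono) auto
  also have "\<dots> = r * (\<kappa> / L) ^ M" by (simp add: power_divide)
  also have "\<dots> \<le> r * (1/2) ^ M"
    using r \<kappa> L by (intro mult_left_mono power_mono) (auto simp: field_simps)
  finally show ?thesis by (simp add: Q_def)
qed

lemma krylov_in_Ints:
  assumes "\<And>i j. i < m \<Longrightarrow> j \<le> m \<Longrightarrow> h (i, j) \<in> \<int>" and "i < m"
  shows "krylov m h k i \<in> \<int>"
  using assms(2)
proof (induction k arbitrary: i)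
  case (Suc k)
  then show ?case by (auto intro!: Ints_sum Ints_mult assms(1))
qed (simp add: assms(1))

section \<open>The probability bound\<close>

text \<open>The exponents are the sums of k and of (k + 1)/2 over k < u. For u = t - 1 they become
  (t - 1)(t - 2)/2 and t(t - 1)/4.\<close>

lemma prod_scales:
  fixes K n :: real
  assumes "K > 0" "n > 0"
  shows "(\<Prod>k<u. (K * sqrt n) ^ k * sqrt n) =
    K powr (real u * (real u - 1) / 2) * n powr ((real u + 1) * real u / 4)"
proof (induction u)
  case (Suc u)
  have sq: "sqrt n = n powr (1/2)" using assms by (simp add: powr_half_sqrt)
  have "(K * sqrt n) ^ u * sqrt n = K powr real u * n powr ((real u + 1) / 2)"
    using assms by (simp add: power_mult_distrib powr_realpow[symmetric] sq powr_powr powr_add[symmetric] add_divide_distrib)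
  then have "(\<Prod>k<Suc u. (K * sqrt n) ^ k * sqrt n) =
      (K powr (real u * (real u - 1) / 2) * K powr real u) *
      (n powr ((real u + 1) * real u / 4) * n powr ((real u + 1) / 2))"
    using Suc by (simp add: mult_ac)
  also have "\<dots> = K powr (real (Suc u) * (real (Suc u) - 1) / 2) * n powr ((real (Suc u) + 1) * real (Suc u) / 4)"
  proof -
    have "real u * (real u - 1) / 2 + real u = real (Suc u) * (real (Suc u) - 1) / 2"
      "(real u + 1) * real u / 4 + (real u + 1) / 2 = (real (Suc u) + 1) * real (Suc u) / 4"
      by (simp_all add: field_simps)
    then show ?thesis by (simp only: powr_add[symmetric])
  qed
  finally show ?case .
qed (use assms in simp)

lemma L2_set_row: "L2_set (\<lambda>e. g (snd e)) ({m} \<times> {..<Suc m}) = sqrt ((g m)\<^sup>2 + (L2_set g {..<m})\<^sup>2)"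
  by (simp add: L2_set_def sum.cartesian_product' sum_nonneg)

lemma sum_row: "(\<Sum>e\<in>{m} \<times> {..<Suc m}. v e * g (snd e)) = v (m, m) * g m + (\<Sum>j<m. v (m, j) * g j)"
  for v :: "nat \<times> nat \<Rightarrow> real"
  by (simp add: sum.cartesian_product')

text \<open>Here p = t - 1. The upper m rows satisfy the norm bound with probability at least 1/2;
  given them, the small ball estimate is applied to the last row with p + 2 functionals: p Krylov
  vectors, the tail and the corner entry.\<close>

lemma lazy_rademacher_matrix_bound:
  fixes m p :: nat and L :: real
  defines "\<kappa> \<equiv> 40 * sqrt (real (Suc m))"
  assumes L: "L \<ge> 2 * \<kappa>"
  shows "measure_pmf.prob (lazy_rademacher_matrix (Suc m))
     {R. smallest_singular_value (diag_L0 (Suc m) L + R) \<le> 2 * (\<kappa> / L) ^ Suc p} \<ge>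
     1/2 * (1 / 162 ^ (p + 2) / (\<Prod>k<p. \<kappa> ^ k * sqrt (real (Suc m))))"
proof -
  define n where "n = Suc m"
  define r where "r = sqrt (real n)"
  have r: "r \<ge> 1" by (simp add: r_def n_def)
  have "\<kappa> = 40 * r" by (simp add: \<kappa>_def r_def n_def)
  with r have \<kappa>: "\<kappa> = 40 * r" "\<kappa> \<ge> 1" by auto
  have L0: "L > 0" using L \<kappa> by simp
  define \<sigma> where "\<sigma> = (\<kappa> / L) ^ Suc p"
  have \<sigma>: "\<sigma> > 0" using \<kappa> L0 by (simp add: \<sigma>_def)
  \<comment> \<open>The truncation length is chosen so that the remainder in the top block is at
    most \<sigma>; the probability bound does not depend on it.\<close>
  obtain M0 where M0: "(1/2 :: real) ^ M0 < \<sigma> / r"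
    using real_arch_pow_inv[of "\<sigma> / r" "1/2"] \<sigma> r by auto
  define M where "M = max p M0"
  have "r * (1/2) ^ M \<le> r * (1/2) ^ M0"
    using r by (intro mult_left_mono power_decreasing) (auto simp: M_def)
  also have "\<dots> \<le> \<sigma>" using M0 r by (simp add: field_simps)
  finally have M: "r * (1/2) ^ M \<le> \<sigma>" "p \<le> M" by (auto simp: M_def)

  define G where "G = {..<m} \<times> {..<Suc m}"
  define W where "W = {m} \<times> {..<Suc m}"
  define PG where "PG = Pi_pmf G 0 (\<lambda>_. lazy_rademacher)"
  define PW where "PW = Pi_pmf W 0 (\<lambda>_. lazy_rademacher)"
  have fin: "finite G" "finite W" by (simp_all add: G_def W_def)
  have split: "{..<Suc m} \<times> {..<Suc m} = G \<union> W" "G \<inter> W = {}" by (auto simp: G_def W_def)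
  have entry_G: "f (i, j) \<in> {0, 1, -1}" if "f \<in> set_pmf PG" "i < m" "j \<le> m" for f i j
    using that by (auto simp: PG_def G_def set_Pi_pmf PiE_dflt_def set_lazy_rademacher)
  have entry_W: "v (m, j) \<in> {0, 1, -1}" if "v \<in> set_pmf PW" "j \<le> m" for v j
    using that by (auto simp: PW_def W_def set_Pi_pmf PiE_dflt_def set_lazy_rademacher)

  define A where "A = {f. \<forall>x. L2_set (\<lambda>i. \<Sum>j<Suc m. f (i, j) * x j) {..<m} \<le> \<kappa> * L2_set x {..<Suc m}}"
  have PA: "measure_pmf.prob PG (A \<inter> set_pmf PG) \<ge> 1/2"
    using lazy_rademacher_op_norm[of "{..<m}" "{..<Suc m}" "real n"]
    unfolding measure_Int_set_pmf A_def PG_def G_def \<kappa> r_def by (simp add: n_def)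
  have kry: "L2_set (krylov m f k) {..<m} \<le> \<kappa> ^ k * r" if f: "f \<in> A \<inter> set_pmf PG" for f k
  proof (rule L2_set_krylov_le)
    fix x :: "nat \<Rightarrow> real"
    \<comment> \<open>Padding with 0 at index m turns the bound for the m by (m + 1) block into one
      for R'.\<close>
    let ?x = "\<lambda>j. if j < m then x j else (0 :: real)"
    have "L2_set (\<lambda>i. \<Sum>j<Suc m. f (i, j) * ?x j) {..<m} \<le> \<kappa> * L2_set ?x {..<Suc m}"
      using f by (simp add: A_def del: sum.lessThan_Suc)
    also have "L2_set ?x {..<Suc m} = L2_set x {..<m}"
      by (simp add: lessThan_Suc L2_set_def)
    finally show "L2_set (\<lambda>i. \<Sum>j<m. f (i, j) * x j) {..<m} \<le> \<kappa> * L2_set x {..<m}" by simp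
  next
    have "L2_set (\<lambda>i. f (i, m)) {..<m} \<le> sqrt (\<Sum>i<m. 1)"
      unfolding L2_set_def
    proof (intro real_sqrt_le_mono sum_mono)
      fix i assume "i \<in> {..<m}"
      then show "(f (i, m))\<^sup>2 \<le> 1" using entry_G[of f i m] f by auto
    qed
    also have "\<dots> \<le> r" by (simp add: r_def n_def)
    finally show "L2_set (\<lambda>i. f (i, m)) {..<m} \<le> r" .
  qed (use \<kappa> in simp)

  \<comment> \<open>Indices below p are the Krylov vectors, index p is the tail divided by \<sigma>
    so that its scale is at most 1, and index p + 1 reads off the corner coordinate m.\<close>
  define \<alpha> where "\<alpha> f k j = (if j < m then if k < p then krylov m f k j
      else if k = p then resolvent_tail m f L p M j / \<sigma> else 0 else if k \<le> p then 0 else 1)" for f k j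
  define s where "s k = (if k < p then \<kappa> ^ k * r else 1)" for k
  define B where "B f = {v. \<forall>k\<in>{..<p + 2}. \<bar>\<Sum>e\<in>W. v e * \<alpha> f k (snd e)\<bar> < 1}" for f
  define b where "b = 1 / 162 ^ (p + 2) / (\<Prod>k<p. \<kappa> ^ k * r)"
  have PB: "measure_pmf.prob PW (B f \<inter> set_pmf PW) \<ge> b" if f: "f \<in> A \<inter> set_pmf PG" for f
  proof -
    have \<alpha>: "L2_set (\<lambda>e. \<alpha> f k (snd e)) W \<le> s k" if k: "k \<in> {..<p + 2}" for k
    proof -
      consider "k < p" | "k = p" | "k = Suc p" using k by fastforce
      then show ?thesis
      proof cases
        case 1
        have "L2_set (\<alpha> f k) {..<m} = L2_set (krylov m f k) {..<m}"
          using 1 by (intro L2_set_cong) (auto simp: \<alpha>_def)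
        moreover have "\<alpha> f k m = 0" using 1 by (simp add: \<alpha>_def)
        ultimately show ?thesis unfolding W_def L2_set_row using kry[OF f, of k] 1 by (simp add: s_def)
      next
        case 2
        have "L2_set (\<alpha> f k) {..<m} = L2_set (\<lambda>j. 1 / \<sigma> * resolvent_tail m f L p M j) {..<m}"
          using 2 by (intro L2_set_cong) (auto simp: \<alpha>_def)
        also have "\<dots> = L2_set (resolvent_tail m f L p M) {..<m} / \<sigma>"
          unfolding L2_set_scale using \<sigma> by simp
        also have "\<dots> \<le> (2 * r / L * (\<kappa> / L) ^ p) / \<sigma>"
          using kry[OF f] r \<kappa> L L0 \<sigma> by (intro divide_right_mono L2_set_resolvent_tail_le) auto
        \<comment> \<open>The quotient equals 2r/\<kappa> = 1/20.\<close>
        also have "\<dots> \<le> 1" using \<sigma> r L0 by (simp add: \<sigma>_def \<kappa> field_simps)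
        finally have "L2_set (\<alpha> f k) {..<m} \<le> 1" .
        moreover have "\<alpha> f k m = 0" using 2 by (simp add: \<alpha>_def)
        ultimately show ?thesis unfolding W_def L2_set_row using 2 by (simp add: s_def)
      next
        case 3
        then show ?thesis unfolding W_def L2_set_row by (simp add: s_def \<alpha>_def L2_set_def)
      qed
    qed
    have "(\<Prod>k<p + 2. 1 / (162 * s k)) \<le> measure_pmf.prob PW (B f)"
      unfolding PW_def B_def
    proof (rule lazy_rademacher_small_ball[OF fin(2) _ _ \<alpha>])
      fix k
      have "1 * 1 \<le> \<kappa> ^ k * r" using \<kappa> r by (intro mult_mono one_le_power) auto
      then show "1 \<le> s k" by (simp add: s_def)
    qed auto
    also have "(\<Prod>k<p + 2. 1 / (162 * s k)) = b"
      by (simp add: b_def s_def prod_dividef prod.distrib)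
    finally show ?thesis by (simp add: measure_Int_set_pmf)
  qed

  have prod_pos: "(\<Prod>k<p. \<kappa> ^ k * r) > 0" using \<kappa> r by (intro prod_pos) auto
  have "1/2 * b \<le> measure_pmf.prob (pair_pmf PG PW) {(f, v). f \<in> A \<inter> set_pmf PG \<and> v \<in> B f \<inter> set_pmf PW}"
    by (rule prob_pair_pmf_ge[OF _ _ PA _ PB])
      (use prod_pos fin in \<open>auto simp: PG_def PW_def b_def finite_set_Pi_lazy\<close>)
  also have "\<dots> \<le> measure_pmf.prob (pair_pmf PG PW)
     {(f, v). smallest_singular_value (diag_L0 n L + Matrix.mat n n (\<lambda>x. if x \<in> G then f x else v x)) \<le> 2 * \<sigma>}"
  proof (rule measure_pmf.finite_measure_mono; clarsimp)
    fix f v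
    assume f: "f \<in> A" "f \<in> set_pmf PG" and v: "v \<in> B f" "v \<in> set_pmf PW"
    \<comment> \<open>The upper rows and the last row are glued in the form that
      \<open>Pi_pmf_union\<close> gives to the joint law.\<close>
    define h where "h x = (if x \<in> G then f x else v x)" for x
    have hf: "h (i, j) = f (i, j)" if "i < m" "j \<le> m" for i j using that by (simp add: h_def G_def)
    have hv: "h (m, j) = v (m, j)" for j by (simp add: h_def G_def)
    have kry_h: "krylov m h k i = krylov m f k i" if "i < m" for k i
      using that by (intro krylov_cong hf)
    have tail_h: "resolvent_tail m h L p M j = resolvent_tail m f L p M j" if "j < m" for j
      using that by (simp add: resolvent_tail_def kry_h)
    have small: "\<bar>v (m, m) * \<alpha> f k m + (\<Sum>j<m. v (m, j) * \<alpha> f k j)\<bar> < 1" if "k < p + 2" for k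
      using v(1) that unfolding B_def W_def sum_row by auto
    have int_zero: "y = 0" if "y \<in> \<int>" "\<bar>y\<bar> < 1" for y :: real
      using that by (auto elim!: Ints_cases)
    have "smallest_singular_value (diag_L0 (Suc m) L + Matrix.mat (Suc m) (Suc m) h) \<le> r * (1/2) ^ M + \<sigma>"
    proof (rule smallest_singular_value_bordered_le[where \<kappa> = \<kappa> and p = p])
      have "L2_set (krylov m h M) {..<m} = L2_set (krylov m f M) {..<m}"
        by (intro L2_set_cong) (auto simp: kry_h)
      then show "L2_set (krylov m h M) {..<m} \<le> \<kappa> ^ M * r" using kry f by simp
      have "\<bar>v (m, m)\<bar> < 1" using small[of "Suc p"] by (simp add: \<alpha>_def)
      then show "h (m, m) = 0" using entry_W[OF v(2), of m] by (auto simp: hv)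
      show "(\<Sum>j<m. h (m, j) * krylov m h k j) = 0" if k: "k < p" for k
      proof (rule int_zero)
        have "(\<Sum>j<m. h (m, j) * krylov m h k j) = (\<Sum>j<m. v (m, j) * krylov m f k j)"
          by (intro sum.cong) (auto simp: hv kry_h)
        then show "\<bar>\<Sum>j<m. h (m, j) * krylov m h k j\<bar> < 1"
          using small[of k] k by (simp add: \<alpha>_def)
        have "h (m, j) \<in> \<int>" if "j \<le> m" for j
          using entry_W[OF v(2) that] by (auto simp: hv)
        moreover have "h (i, j) \<in> \<int>" if "i < m" "j \<le> m" for i j
          using entry_G[OF f(2) that] by (auto simp: hf that)
        ultimately show "(\<Sum>j<m. h (m, j) * krylov m h k j) \<in> \<int>"
          by (intro Ints_sum Ints_mult krylov_in_Ints) auto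
      qed
      have "(\<Sum>j<m. h (m, j) * resolvent_tail m h L p M j) = \<sigma> * (\<Sum>j<m. v (m, j) * \<alpha> f p j)"
        unfolding sum_distrib_left using \<sigma> by (intro sum.cong) (auto simp: hv tail_h \<alpha>_def)
      moreover have "\<bar>\<Sum>j<m. v (m, j) * \<alpha> f p j\<bar> < 1"
        using small[of p] by (simp add: \<alpha>_def)
      ultimately show "\<bar>\<Sum>j<m. h (m, j) * resolvent_tail m h L p M j\<bar> \<le> \<sigma>"
        using \<sigma> by (simp add: abs_mult mult_left_le)
    qed (use \<kappa> L L0 r M in auto)
    then show "smallest_singular_value (diag_L0 n L + Matrix.mat n n (\<lambda>x. if x \<in> G then f x else v x)) \<le> 2 * \<sigma>"
      using M by (simp add: n_def h_def[abs_def])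
  qed
  also have "\<dots> = measure_pmf.prob (lazy_rademacher_matrix (Suc m))
     {R. smallest_singular_value (diag_L0 (Suc m) L + R) \<le> 2 * \<sigma>}"
    unfolding lazy_rademacher_matrix_def split Pi_pmf_union[OF fin split(2)] PG_def[symmetric] PW_def[symmetric]
      measure_map_pmf
    by (rule arg_cong[of _ _ "measure_pmf.prob _"]) (auto simp: n_def)
  finally show ?thesis by (simp add: \<sigma>_def b_def r_def n_def)
qed

theorem theorem1p4:
  shows "\<exists>K C :: real. K > 0 \<and> C > 0 \<and>
    (\<forall>t :: nat. t \<ge> 1 \<longrightarrow>
      (\<exists>N :: nat. \<forall>n \<ge> N. \<forall>L :: real. L \<ge> 2 * K * sqrt (real n) \<longrightarrow>
        measure_pmf.prob (lazy_rademacher_matrix n)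
          {R. smallest_singular_value (diag_L0 n L + R) \<le> C * (K * sqrt (real n) / L) ^ t}
        \<ge> (4 * C) powr (- real t)
          * K powr (- ((real t - 1) * (real t - 2) / 2))
          * (ln (2 * real t)) powr (1 - real t)
          * (real n) powr (- (real t * (real t - 1) / 4))))"
proof -
  \<comment> \<open>40 is the constant of the operator norm bound, and 4 * 13122 = 2 * 162^2 makes
    (4C)^(-t) equal, at t = 1, to the constant 1/2 * 162^(-2) of
    \<open>lazy_rademacher_matrix_bound\<close>.\<close>
  define K C :: real where "K = 40" and "C = 13122"
  have bound: "(4 * C) powr (- real t) * K powr (- ((real t - 1) * (real t - 2) / 2))
          * (ln (2 * real t)) powr (1 - real t) * (real n) powr (- (real t * (real t - 1) / 4))
       \<le> measure_pmf.prob (lazy_rademacher_matrix n)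
          {R. smallest_singular_value (diag_L0 n L + R) \<le> C * (K * sqrt (real n) / L) ^ t}"
    if t: "t \<ge> 1" and n: "n \<ge> 1" and L: "L \<ge> 2 * K * sqrt (real n)" for t n :: nat and L :: real
  proof -
    obtain p where p: "t = Suc p" using t by (cases t) auto
    obtain m where m: "n = Suc m" using n by (cases n) auto
    define D where "D = K powr (real p * (real p - 1) / 2) * real n powr ((real p + 1) * real p / 4)"
    have D: "D = (\<Prod>k<p. (40 * sqrt (real (Suc m))) ^ k * sqrt (real (Suc m)))"
      unfolding D_def K_def m using prod_scales[of 40 "real (Suc m)" p] by simp
    have D0: "D > 0" unfolding D_def K_def using n by simp
    have "0 < 2 * K * sqrt (real n)" using n by (simp add: K_def)
    then have L0: "L > 0" using L by linarith
    \<comment> \<open>For t \<ge> 2 one has 2t \<ge> 4 > e, so the logarithm is at least 1 and its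
      exponent is negative; for t = 1 the exponent is 0.\<close>
    have ln: "(ln (2 * real t)) powr (1 - real t) \<le> 1"
    proof (cases "t = 1")
      case False
      then have "exp 1 \<le> 2 * real t" using t exp_le by simp
      then have "1 \<le> ln (2 * real t)" using t by (simp add: ln_ge_iff)
      then show ?thesis using powr_mono[of "1 - real t" 0 "ln (2 * real t)"] t by simp
    qed simp
    have C: "(4 * C) powr (- real t) \<le> 1/2 * (1 / 162 ^ (p + 2))"
    proof -
      have "2 * 162 ^ (p + 2) \<le> (52488 :: real) ^ Suc p"
      proof (induction p)
        case (Suc p)
        have "2 * 162 ^ (Suc p + 2) = 162 * (2 * 162 ^ (p + 2) :: real)" by simp
        also have "\<dots> \<le> 52488 * 52488 ^ Suc p" using Suc by (intro mult_mono) auto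
        finally show ?case by simp
      qed simp
      then have "1 / (52488 :: real) ^ Suc p \<le> 1 / (2 * 162 ^ (p + 2))"
        by (intro divide_left_mono) auto
      moreover have "(4 * C) powr (- real t) = 1 / 52488 ^ Suc p"
        unfolding C_def p powr_minus_divide by (subst powr_realpow) simp_all
      ultimately show ?thesis by simp
    qed
    have "(4 * C) powr (- real t) * K powr (- ((real t - 1) * (real t - 2) / 2))
          * (ln (2 * real t)) powr (1 - real t) * (real n) powr (- (real t * (real t - 1) / 4)) =
        (4 * C) powr (- real t) * (ln (2 * real t)) powr (1 - real t) * (1 / D)"
    proof -
      have "(real t - 1) * (real t - 2) / 2 = real p * (real p - 1) / 2"
        "real t * (real t - 1) / 4 = (real p + 1) * real p / 4"
        by (simp_all add: p algebra_simps)
      then show ?thesis unfolding D_def powr_minus_divide by simp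
    qed
    also have "\<dots> \<le> (1/2 * (1 / 162 ^ (p + 2))) * 1 * (1 / D)"
      using C ln D0 by (intro mult_mono) auto
    also have "\<dots> = 1/2 * (1 / 162 ^ (p + 2) / D)" by simp
    also have "\<dots> \<le> measure_pmf.prob (lazy_rademacher_matrix n)
        {R. smallest_singular_value (diag_L0 n L + R) \<le> 2 * (40 * sqrt (real n) / L) ^ t}"
      unfolding D p m using L by (intro lazy_rademacher_matrix_bound) (simp add: K_def m)
    also have "\<dots> \<le> measure_pmf.prob (lazy_rademacher_matrix n)
        {R. smallest_singular_value (diag_L0 n L + R) \<le> C * (K * sqrt (real n) / L) ^ t}"
    proof (intro measure_pmf.finite_measure_mono subsetI CollectI; clarsimp)
      fix R :: "real mat"
      assume "smallest_singular_value (diag_L0 n L + R) \<le> 2 * (40 * sqrt (real n) / L) ^ t"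
      also have "\<dots> \<le> C * (K * sqrt (real n) / L) ^ t"
        unfolding K_def C_def using L0 by (intro mult_right_mono zero_le_power) auto
      finally show "smallest_singular_value (diag_L0 n L + R) \<le> C * (K * sqrt (real n) / L) ^ t" .
    qed
    finally show ?thesis .
  qed
  show ?thesis
    using bound by (intro exI[of _ K] exI[of _ C] conjI allI impI exI[of _ 1]) (auto simp: K_def C_def)
qed

end
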